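(* We have $$S_2\!\left(e^{-3\sqrt{5}\pi}\right)=\frac{1}{\sqrt{2}}\left(\sqrt{\frac{\sqrt{5}+3}{4}}-\sqrt{\frac{\sqrt{5}-1}{4}}\right)^2\left(\sqrt{\frac{3\sqrt{5}+7}{4}}-\sqrt{\frac{3\sqrt{5}+3}{4}}\right),$$ $$S_2\!\left(e^{-\sqrt{5}\pi/3}\right)=\frac{1}{\sqrt{2}}\left(\sqrt{\frac{\sqrt{5}+3}{4}}-\sqrt{\frac{\sqrt{5}-1}{4}}\right)^2\left(\sqrt{\frac{3\sqrt{5}+7}{4}}+\sqrt{\frac{3\sqrt{5}+3}{4}}\right),$$ $$S_2\!\left(e^{-3\sqrt{7}\pi}\right)=\frac{1}{\sqrt{2}}\left(\frac{3-\sqrt{7}}{\sqrt{2}}\right)^{1/2}\left(\frac{\sqrt{3}-1}{\sqrt{2}}\right)\left(\sqrt{\frac{\sqrt{21}+5}{2}}-\sqrt{\frac{\sqrt{21}+3}{2}}\right),$$ $$S_2\!\left(e^{-\sqrt{7}\pi/3}\right)=\frac{1}{\sqrt{2}}\left(\frac{3-\sqrt{7}}{\sqrt{2}}\right)^{1/2}\left(\frac{\sqrt{3}-1}{\sqrt{2}}\right)\left(\sqrt{\frac{\sqrt{21}+5}{2}}+\sqrt{\frac{\sqrt{21}+3}{2}}\right).$$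
   Context: For $|x|<1$ let $(a;x)_\infty=\prod_{k\ge0}(1-ax^k)$. For $0<q<1$, $S_2(q)=\dfrac{q^{1/8}(-q^2;q^2)_\infty}{(q;q^2)_\infty}$ (equal to the continued fraction $\frac{q^{1/8}}{1+}\frac{-q}{1+}\frac{-q+q^2}{1+}\frac{-q^3}{1+}\frac{q^2+q^4}{1+}\cdots$), with $q^{1/8}$ the positive real root. *)

theory Defs
  imports "HOL-Analysis.Analysis"
begin

definition qpochhammer_inf :: "'a \<Rightarrow> 'a \<Rightarrow> 'a::real_normed_field"
  where "qpochhammer_inf a x = (\<Prod>k. 1 - a * x ^ k)"

text \<open>Intended for \<open>0 < q < 1\<close>, where \<^term>\<open>root 8 q\<close> is the positive real eighth root.\<close>

definition S2 :: "real \<Rightarrow> real"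
  where "S2 q = root 8 q * qpochhammer_inf (- (q ^ 2)) (q ^ 2) / qpochhammer_inf q (q ^ 2)"

end

theory Submission
  imports Defs
begin

text \<open>
  Write \<open>q = exp (- pi * t)\<close>. By the Jacobi triple product the square of \<open>S2 q\<close> is half the quotient \<open>u(t)\<close> of the theta constants
  \<open>jacobi2 t\<close> and \<open>jacobi4 t\<close>. Sorting the terms of binary theta series along the norm forms
  \<open>m\<^sup>2 + n\<^sup>2\<close>, \<open>m\<^sup>2 + 3 n\<^sup>2\<close> and \<open>m\<^sup>2 + 7 n\<^sup>2\<close> gives modular equations of degrees 2, 3, 5 and 7, and the inversion
  \<open>t \<mapsto> 1 / t\<close> exchanges \<open>jacobi2\<close> and \<open>jacobi4\<close>. At \<open>t = 1 / sqrt n\<close> the equation of degree \<open>n = 5, 7\<close> relates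
  \<open>1 / sqrt n\<close> to \<open>sqrt n\<close>, so together with the inversion it determines \<open>u(sqrt n)\<close>. The degree 3 equation is then a
  quartic satisfied by both \<open>u(sqrt n / 3)\<close> and \<open>u(3 * sqrt n)\<close>; it has only two positive roots, and monotonicity of
  \<open>S2\<close> tells them apart.
\<close>

section \<open>Theta series of sets of integers\<close>

text \<open>Since \<open>n * (1 / sqrt n) = sqrt n\<close>, inversion carries every theta constant
  in a degree n equation at \<open>1 / sqrt n\<close> back to the point \<open>sqrt n\<close> (for n
  = 7 also to \<open>sqrt 7 / 2\<close> and \<open>2 * sqrt 7\<close>, which the doubling formulas
  remove). What remains is symmetric in \<open>jacobi2\<close> and \<open>jacobi4\<close> and so
  yields only \<open>u^2 + 1 / u^2\<close>. The choice between u and its reciprocal is made by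
  \<open>u(1) = 1\<close> and monotonicity. Degree 5 is the hard case. The changes of variables in
  degrees 3 and 7 involve congruences mod 2 and 4 only, and the even and odd parts of a theta series
  are theta constants again. An element of norm 5 produces residue classes mod 5 instead, whose
  series are not theta constants. The triple product turns them into infinite products that combine
  into a product over odd exponents, and its sixth power is expressible by theta constants; hence
  the sixth power in the equation of degree 5.\<close>

lemma summable_on_int_exp_abs:
  assumes "c > 0"
  shows "(\<lambda>n::int. exp (- c * \<bar>real_of_int n\<bar>)) summable_on UNIV"
proof -
  let ?f = "\<lambda>n::int. exp (- c * \<bar>real_of_int n\<bar>)"
  have "summable (\<lambda>n. exp (- c) ^ n)"
    using assms by (intro summable_geometric) auto
  then have s: "(\<lambda>n::nat. exp (- c) ^ n) summable_on UNIV"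
    by (intro norm_summable_imp_summable_on) auto
  have 1: "exp (- c) ^ n = exp (- c * real n)" for n
    by (simp flip: exp_of_nat_mult add: mult.commute)
  have "?f summable_on range int"
    by (subst summable_on_reindex) (use s in \<open>auto simp: o_def 1\<close>)
  moreover have "?f summable_on range (\<lambda>n. - int n)"
    by (subst summable_on_reindex) (use s in \<open>auto simp: o_def 1 inj_on_def\<close>)
  ultimately have "?f summable_on (range int \<union> range (\<lambda>n. - int n))"
    by (rule summable_on_union)
  moreover have "range int \<union> range (\<lambda>n. - int n) = UNIV"
  proof -
    have "x \<in> range int \<union> range (\<lambda>n. - int n)" for x
      by (cases x rule: int_cases2) auto
    then show ?thesis by blast
  qed
  ultimately show ?thesis by simp
qed

text \<open>Completing the square compares the Gaussian with \<open>exp (- |n|)\<close>. The linear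
  term is carried along because the shifted Gaussians of the inversion formula and the factors
  \<open>z powi j\<close> of the triple product have majorants of this shape.\<close>

lemma summable_on_int_gauss:
  fixes a c :: real
  assumes "c > 0"
  shows "(\<lambda>n::int. exp (a * \<bar>of_int n\<bar> - c * (of_int n)\<^sup>2)) summable_on S"
proof -
  have "(\<lambda>n::int. exp ((a + 1)\<^sup>2 / (4 * c)) * exp (- 1 * \<bar>real_of_int n\<bar>)) summable_on UNIV"
    by (intro summable_on_cmult_right summable_on_int_exp_abs) auto
  moreover have "exp (a * \<bar>of_int n\<bar> - c * (of_int n)\<^sup>2) \<le>
      exp ((a + 1)\<^sup>2 / (4 * c)) * exp (- 1 * \<bar>real_of_int n\<bar>)" for n :: int
  proof -
    define x where "x = \<bar>real_of_int n\<bar>"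
    have x2: "(of_int n)\<^sup>2 = x\<^sup>2" by (simp add: x_def)
    have "0 \<le> (2 * c * x - (a + 1))\<^sup>2 / (4 * c)"
      using assms by simp
    also have "\<dots> = c * x\<^sup>2 - (a + 1) * x + (a + 1)\<^sup>2 / (4 * c)"
      using assms by (simp add: field_simps power2_eq_square)
    finally show ?thesis
      unfolding x2 x_def[symmetric] by (simp flip: exp_add add: algebra_simps)
  qed
  ultimately have "(\<lambda>n::int. exp (a * \<bar>of_int n\<bar> - c * (of_int n)\<^sup>2)) summable_on UNIV"
    by (rule summable_on_comparison_test) auto
  then show ?thesis by (rule summable_on_subset) simp
qed

text \<open>With \<open>q = exp (- pi * t)\<close> the terms are q^(n^2). An arbitrary index set
  makes parity classes and residue classes mod 5 instances of one notion, so that splitting and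
  reindexing take the place of characters.\<close>

definition theta :: "real \<Rightarrow> int set \<Rightarrow> real"
  where "theta t S = (\<Sum>\<^sub>\<infinity>n\<in>S. exp (- pi * t * (of_int n)\<^sup>2))"

lemma theta_summable:
  assumes "t > 0"
  shows "(\<lambda>n::int. exp (- pi * t * (of_int n)\<^sup>2)) summable_on S"
  using summable_on_int_gauss[of "pi * t" 0 S] assms by simp

lemma theta_union:
  assumes "t > 0" "A \<inter> B = {}"
  shows "theta t (A \<union> B) = theta t A + theta t B"
  unfolding theta_def by (intro infsum_Un_disjoint theta_summable assms)

lemma theta_even_odd:
  assumes "t > 0"
  shows "theta t UNIV = theta t {n. even n} + theta t {n. odd n}"
proof -
  have "(UNIV :: int set) = {n. even n} \<union> {n. odd n}" by auto
  then show ?thesis using theta_union[OF assms, of "{n. even n}" "{n. odd n}"] by auto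
qed

text \<open>The index set need not be a product: the sublattices that arise from multiplication by a
  quadratic integer are cut out by congruences linking m and n.\<close>

definition theta_pair :: "real \<Rightarrow> real \<Rightarrow> (int \<times> int) set \<Rightarrow> real"
  where "theta_pair s t S = (\<Sum>\<^sub>\<infinity>(m, n)\<in>S. exp (- pi * (s * (of_int m)\<^sup>2 + t * (of_int n)\<^sup>2)))"

lemma theta_pair_has_sum:
  assumes "s > 0" "t > 0"
  shows "((\<lambda>(m, n). exp (- pi * (s * (of_int m)\<^sup>2 + t * (of_int n)\<^sup>2))) has_sum (theta s A * theta t B)) (A \<times> B)"
proof (rule has_sum_SigmaI)
  have e: "exp (- pi * (s * (of_int m)\<^sup>2 + t * (of_int n)\<^sup>2))
      = exp (- pi * s * (of_int m)\<^sup>2) * exp (- pi * t * (of_int n)\<^sup>2)" for m n :: int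
    by (simp flip: exp_add add: algebra_simps)
  have hs: "((\<lambda>n::int. exp (- pi * u * (of_int n)\<^sup>2)) has_sum theta u S) S" if "u > 0" for u S
    unfolding theta_def by (intro has_sum_infsum theta_summable that)
  show 1: "((\<lambda>n. case (m, n) of (m, n) \<Rightarrow> exp (- pi * (s * (of_int m)\<^sup>2 + t * (of_int n)\<^sup>2)))
      has_sum exp (- pi * s * (of_int m)\<^sup>2) * theta t B) B" for m :: int
    unfolding prod.case e by (intro has_sum_cmult_right hs assms)
  show 2: "((\<lambda>m::int. exp (- pi * s * (of_int m)\<^sup>2) * theta t B) has_sum theta s A * theta t B) A"
    by (intro has_sum_cmult_left hs assms)
  show "(\<lambda>(m, n). exp (- pi * (s * (of_int m)\<^sup>2 + t * (of_int n)\<^sup>2))) summable_on A \<times> B"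
    by (rule summable_on_SigmaI[where g = "\<lambda>m. exp (- pi * s * (of_int m)\<^sup>2) * theta t B"])
       (use 1 2 in \<open>auto simp: summable_on_def\<close>)
qed

lemma theta_pair_summable:
  assumes "s > 0" "t > 0"
  shows "(\<lambda>(m, n). exp (- pi * (s * (of_int m)\<^sup>2 + t * (of_int n)\<^sup>2))) summable_on S"
  using has_sum_imp_summable[OF theta_pair_has_sum[OF assms, of UNIV UNIV]]
  by (rule summable_on_subset) simp

lemma theta_mult:
  assumes "s > 0" "t > 0"
  shows "theta s A * theta t B = theta_pair s t (A \<times> B)"
  unfolding theta_pair_def by (rule infsumI[symmetric], rule theta_pair_has_sum[OF assms])

lemma theta_pair_union:
  assumes "s > 0" "t > 0" "A \<inter> B = {}"
  shows "theta_pair s t (A \<union> B) = theta_pair s t A + theta_pair s t B"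
  unfolding theta_pair_def by (intro infsum_Un_disjoint theta_pair_summable assms)

text \<open>All the arithmetic of the modular equations passes through this rule: a bijection of
  index sets that carries one diagonal form into another preserves the double series.\<close>

lemma theta_pair_reindex:
  assumes bij: "bij_betw i T S"
    and form: "\<And>m n k l. (m, n) \<in> T \<Longrightarrow> i (m, n) = (k, l) \<Longrightarrow>
      s * (real_of_int k)\<^sup>2 + t * (real_of_int l)\<^sup>2 = s' * (real_of_int m)\<^sup>2 + t' * (real_of_int n)\<^sup>2"
  shows "theta_pair s t S = theta_pair s' t' T"
proof -
  let ?f = "\<lambda>s t (m, n). exp (- pi * (s * (real_of_int m)\<^sup>2 + t * (real_of_int n)\<^sup>2))"
  have "infsum (?f s t) S = infsum (\<lambda>x. ?f s t (i x)) T"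
    by (rule infsum_reindex_bij_betw[OF bij, symmetric])
  also have "\<dots> = infsum (?f s' t') T"
  proof (rule infsum_cong)
    fix x assume x: "x \<in> T"
    obtain m n where mn: "x = (m, n)" by fastforce
    obtain k l where kl: "i (m, n) = (k, l)" by fastforce
    have "s * (real_of_int k)\<^sup>2 + t * (real_of_int l)\<^sup>2 = s' * (real_of_int m)\<^sup>2 + t' * (real_of_int n)\<^sup>2"
      by (rule form) (use x mn kl in simp_all)
    then show "?f s t (i x) = ?f s' t' x"
      by (simp only: mn kl prod.case)
  qed
  finally show ?thesis by (simp only: theta_pair_def)
qed

section \<open>Changes of variables for norm forms\<close>

lemma theta_pair_even_sum:
  assumes "s > 0" "t > 0"
  shows "theta_pair s t {(m, n). even (m + n)}
    = theta s {n. even n} * theta t {n. even n} + theta s {n. odd n} * theta t {n. odd n}"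
proof -
  have eq: "{(m, n). even (m + n)} = {n. even n} \<times> {n. even n} \<union> {n. odd n} \<times> {n. odd n}"
    by auto
  show ?thesis
    unfolding theta_mult[OF assms] eq by (rule theta_pair_union, use assms in auto)
qed

lemma theta_pair_odd_sum:
  assumes "s > 0" "t > 0"
  shows "theta_pair s t {(m, n). odd (m + n)}
    = theta s {n. even n} * theta t {n. odd n} + theta s {n. odd n} * theta t {n. even n}"
proof -
  have eq: "{(m, n). odd (m + n)} = {n. even n} \<times> {n. odd n} \<union> {n. odd n} \<times> {n. even n}"
    by auto
  show ?thesis
    unfolding theta_mult[OF assms] eq by (rule theta_pair_union, use assms in auto)
qed

text \<open>\<open>(a + b)^2 + (a - b)^2 = 2 * (a^2 + b^2)\<close>: up to conjugation the
  substitution is multiplication of Gaussian integers by \<open>1 + i\<close>, whose image consists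
  of exactly the pairs of even sum.\<close>

lemma theta_even_sq_plus_odd_sq:
  assumes "t > 0"
  shows "(theta t {n. even n})\<^sup>2 + (theta t {n. odd n})\<^sup>2 = (theta (2 * t) UNIV)\<^sup>2"
proof -
  let ?i = "\<lambda>(a, b). (a + b, a - b :: int)"
  have "bij_betw ?i (UNIV \<times> UNIV) {(m, n). even (m + n)}"
  proof (rule bij_betw_imageI)
    show "?i ` (UNIV \<times> UNIV) = {(m, n). even (m + n)}"
    proof safe
      fix m n :: int assume "even (m + n)"
      then obtain c where "m + n = 2 * c" by (elim dvdE)
      then have "(m, n) = ?i (c, m - c)" by simp
      then show "(m, n) \<in> ?i ` (UNIV \<times> UNIV)" by blast
    qed auto
  qed (auto simp: inj_on_def)
  then have "theta_pair t t {(m, n). even (m + n)} = theta_pair (2 * t) (2 * t) (UNIV \<times> UNIV)"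
    by (rule theta_pair_reindex) (auto simp: algebra_simps power2_eq_square)
  then show ?thesis
    using assms unfolding theta_pair_even_sum[OF assms assms] by (simp add: power2_eq_square theta_mult)
qed

text \<open>The same substitution, restricted to pairs of odd sum, reaches exactly the pairs of odd
  numbers. The two mixed parity products are equal, whence the factor 2.\<close>

lemma theta_even_times_odd:
  assumes "t > 0"
  shows "2 * (theta t {n. even n} * theta t {n. odd n}) = (theta (t / 2) {n. odd n})\<^sup>2"
proof -
  let ?i = "\<lambda>(a, b). (a + b, a - b :: int)"
  have "bij_betw ?i {(m, n). odd (m + n)} ({n. odd n} \<times> {n. odd n})"
  proof (rule bij_betw_imageI)
    show "?i ` {(m, n). odd (m + n)} = {n. odd n} \<times> {n. odd n}"
    proof safe
      fix m n :: int assume mn: "odd m" "odd n"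
      then obtain c where c: "m + n = 2 * c" by (metis dvd_def odd_even_add)
      then have "(m, n) = ?i (c, m - c)" by simp
      moreover have "odd (c + (m - c))" using mn by simp
      ultimately show "(m, n) \<in> ?i ` {(m, n). odd (m + n)}" by blast
    qed auto
  qed (auto simp: inj_on_def)
  then have "theta_pair (t / 2) (t / 2) ({n. odd n} \<times> {n. odd n}) = theta_pair t t {(m, n). odd (m + n)}"
    by (rule theta_pair_reindex) (clarsimp, simp add: field_simps power2_eq_square)
  then show ?thesis
    unfolding power2_eq_square theta_mult[OF half_gt_zero half_gt_zero, OF assms assms]
      theta_pair_odd_sum[OF assms assms] by (simp add: mult.commute)
qed

text \<open>Changing the sign of n exchanges the classes \<open>m = n\<close> and
  \<open>m = - n\<close> mod 4 of odd pairs. The substitutions in degrees 3 and 7 reach only one of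
  them.\<close>

lemma theta_pair_odd_odd:
  assumes "s > 0" "t > 0"
  shows "theta s {n. odd n} * theta t {n. odd n} = 2 * theta_pair s t {(m, n). odd m \<and> odd n \<and> 4 dvd m - n}"
proof -
  have eq: "{n. odd n} \<times> {n. odd n} = {(m, n). odd m \<and> odd n \<and> 4 dvd m - n} \<union>
      {(m, n::int). odd m \<and> odd n \<and> \<not> 4 dvd m - n}" by auto
  have "theta s {n. odd n} * theta t {n. odd n} = theta_pair s t {(m, n). odd m \<and> odd n \<and> 4 dvd m - n} +
     theta_pair s t {(m, n). odd m \<and> odd n \<and> \<not> 4 dvd m - n}"
    unfolding theta_mult[OF assms] eq by (rule theta_pair_union, use assms in auto)
  moreover have "theta_pair s t {(m, n). odd m \<and> odd n \<and> \<not> 4 dvd m - n} =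
      theta_pair s t {(m, n). odd m \<and> odd n \<and> 4 dvd m - n}"
  proof (rule theta_pair_reindex)
    have *: "4 dvd m + n \<longleftrightarrow> \<not> 4 dvd m - n" if "odd m" "odd n" for m n :: int
      using that by presburger
    show "bij_betw (\<lambda>(m, n). (m, - n)) {(m, n). odd m \<and> odd n \<and> 4 dvd m - n}
        {(m, n::int). odd m \<and> odd n \<and> \<not> 4 dvd m - n}"
      by (rule bij_betwI[of _ _ _ "\<lambda>(m, n). (m, - n)"]) (auto simp: *)
  qed auto
  ultimately show ?thesis by simp
qed

text \<open>The substitution is multiplication by the unit \<open>(1 - sqrt (- 3)) / 2\<close> of the Eisenstein integers, followed by conjugation.\<close>

lemma theta_degree_3:
  assumes "t > 0"
  shows "theta t {n. even n} * theta (3 * t) {n. odd n} + theta t {n. odd n} * theta (3 * t) {n. even n}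
    = theta (t / 4) {n. odd n} * theta (3 * t / 4) {n. odd n} / 2"
proof -
  let ?i = "\<lambda>(a, b). (a + 3 * b, a - b :: int)"
  have "bij_betw ?i {(m, n). odd (m + n)} {(m, n). odd m \<and> odd n \<and> 4 dvd m - n}"
  proof (rule bij_betw_imageI)
    show "?i ` {(m, n). odd (m + n)} = {(m, n). odd m \<and> odd n \<and> 4 dvd m - n}"
    proof safe
      fix m n :: int assume mn: "odd m" "odd n" "4 dvd m - n"
      then obtain c where c: "m - n = 4 * c" by (elim dvdE)
      then have "(m, n) = ?i (n + c, c)" by simp
      moreover have "odd (n + c + c)" using mn by simp
      ultimately show "(m, n) \<in> ?i ` {(m, n). odd (m + n)}" by blast
    qed auto
  qed (auto simp: inj_on_def)
  then have "theta_pair (t / 4) (3 * t / 4) {(m, n). odd m \<and> odd n \<and> 4 dvd m - n} =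
      theta_pair t (3 * t) {(m, n). odd (m + n)}"
    by (rule theta_pair_reindex) (clarsimp, simp add: field_simps power2_eq_square)
  then show ?thesis
    using assms theta_pair_odd_sum[of t "3 * t"] theta_pair_odd_odd[of "t / 4" "3 * t / 4"] by simp
qed

text \<open>The substitution is multiplication by \<open>(1 + sqrt (- 7)) / 2\<close>, an element of norm 2.\<close>

lemma theta_degree_7:
  assumes "t > 0"
  shows "theta (t / 2) {n. even n} * theta (7 * t / 2) {n. even n} +
      theta (t / 2) {n. odd n} * theta (7 * t / 2) {n. odd n}
    = theta t {n. even n} * theta (7 * t) {n. even n} + theta t {n. odd n} * theta (7 * t) {n. odd n}
      + theta (t / 4) {n. odd n} * theta (7 * t / 4) {n. odd n} / 2"
proof -
  let ?i = "\<lambda>(m, n). ((m - 7 * n) div 2, (m + n) div 2 :: int)"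
  \<comment> \<open>The map divides by 2, so integrality is made explicit: with
    \<open>m + n = 2 * c\<close> the image is \<open>(c - 4 * n, c)\<close>, whose coordinates
    differ by a multiple of 4.\<close>
  have i: "\<exists>c. m = 2 * c - n \<and> (m - 7 * n) div 2 = c - 4 * n \<and> (m + n) div 2 = c" if "even (m + n)" for m n :: int
  proof -
    obtain c where c: "m + n = 2 * c" using \<open>even (m + n)\<close> by (elim dvdE)
    then have "m = 2 * c - n" "m - 7 * n = 2 * (c - 4 * n)" by simp_all
    with c show ?thesis by auto
  qed
  have "bij_betw ?i {(m, n). even (m + n)} {(m, n). 4 dvd n - m}"
  proof (rule bij_betw_imageI)
    show "inj_on ?i {(m, n). even (m + n)}"
    proof (rule inj_onI, clarify)
      fix m n m' n' :: int
      assume e: "even (m + n)" "even (m' + n')" and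
        eq: "(m - 7 * n) div 2 = (m' - 7 * n') div 2" "(m + n) div 2 = (m' + n') div 2"
      obtain c c' where "m = 2 * c - n" "m' = 2 * c' - n'" "(m - 7 * n) div 2 = c - 4 * n" "(m + n) div 2 = c"
        "(m' - 7 * n') div 2 = c' - 4 * n'" "(m' + n') div 2 = c'"
        using i[OF e(1)] i[OF e(2)] by blast
      with eq show "m = m' \<and> n = n'" by simp
    qed
    show "?i ` {(m, n). even (m + n)} = {(m, n). 4 dvd n - m}"
    proof safe
      fix m n :: int assume "even (m + n)"
      from i[OF this] obtain c where "(m - 7 * n) div 2 = c - 4 * n" "(m + n) div 2 = c"
        by blast
      then show "4 dvd (m + n) div 2 - (m - 7 * n) div 2" by simp
    next
      fix m n :: int assume "4 dvd n - m"
      then obtain c where c: "n - m = 4 * c" by (elim dvdE)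
      have "(m, n) = ?i (2 * n - c, c)" using c by simp
      moreover have "even (2 * n - c + c)" by simp
      ultimately show "(m, n) \<in> ?i ` {(m, n). even (m + n)}" by blast
    qed
  qed
  then have "theta_pair (t / 4) (7 * t / 4) {(m, n). 4 dvd n - m} = theta_pair (t / 2) (7 * t / 2) {(m, n). even (m + n)}"
  proof (rule theta_pair_reindex)
    fix m n k l assume "(m, n) \<in> {(m, n). even (m + n)}" "?i (m, n) = (k, l)"
    then have eqs: "m = 2 * l - n" "k = l - 4 * n"
      using i[of m n] by auto
    show "t / 4 * (real_of_int k)\<^sup>2 + 7 * t / 4 * (real_of_int l)\<^sup>2 =
        t / 2 * (real_of_int m)\<^sup>2 + 7 * t / 2 * (real_of_int n)\<^sup>2"
      unfolding eqs by (simp add: field_simps power2_eq_square)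
  qed
  \<comment> \<open>The image splits by parity. Its odd part is half of all odd pairs; its even part
    is twice the lattice of even sums, which returns the series at the parameter t itself.\<close>
  moreover have "{(m, n). 4 dvd n - m} = {(m, n::int). even m \<and> even n \<and> 4 dvd m - n} \<union>
      {(m, n). odd m \<and> odd n \<and> 4 dvd m - n}"
  proof -
    have "even m \<longleftrightarrow> even n" if "4 dvd m - n" for m n :: int
    proof -
      obtain c where "m - n = 4 * c" using \<open>4 dvd m - n\<close> by (elim dvdE)
      then have "m = n + 2 * (2 * c)" by simp
      then show ?thesis by simp
    qed
    then show ?thesis unfolding dvd_diff_commute[of 4 _ _] by blast
  qed
  moreover have "theta_pair (t / 4) (7 * t / 4) ({(m, n::int). even m \<and> even n \<and> 4 dvd m - n} \<union>
      {(m, n). odd m \<and> odd n \<and> 4 dvd m - n}) = theta_pair (t / 4) (7 * t / 4) {(m, n). even m \<and> even n \<and> 4 dvd m - n} +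
       theta_pair (t / 4) (7 * t / 4) {(m, n). odd m \<and> odd n \<and> 4 dvd m - n}"
    using assms by (intro theta_pair_union) auto
  moreover have "theta_pair (t / 4) (7 * t / 4) {(m, n). even m \<and> even n \<and> 4 dvd m - n} =
      theta_pair t (7 * t) {(m, n). even (m + n)}"
  proof (rule theta_pair_reindex)
    show "bij_betw (\<lambda>(a, b). (2 * a, 2 * b)) {(m, n). even (m + n)} {(m, n::int). even m \<and> even n \<and> 4 dvd m - n}"
    proof (rule bij_betw_imageI)
      have *: "4 dvd 2 * a - 2 * b \<longleftrightarrow> even (a + b)" for a b :: int by presburger
      show "(\<lambda>(a, b). (2 * a, 2 * b)) ` {(m, n). even (m + n)} = {(m, n::int). even m \<and> even n \<and> 4 dvd m - n}"
      proof safe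
        fix m n :: int assume mn: "even m" "even n" "4 dvd m - n"
        then obtain a b where "m = 2 * a" "n = 2 * b" by (elim dvdE)
        with mn(3) have "(m, n) = (\<lambda>(a, b). (2 * a, 2 * b)) (a, b)" "even (a + b)" by (simp_all add: *)
        then show "(m, n) \<in> (\<lambda>(a, b). (2 * a, 2 * b)) ` {(m, n). even (m + n)}" by blast
      qed (auto simp: *)
    qed (auto simp: inj_on_def)
  qed (auto simp: field_simps power2_eq_square)
  ultimately show ?thesis
    using assms theta_pair_even_sum[of t "7 * t"] theta_pair_even_sum[of "t / 2" "7 * t / 2"]
      theta_pair_odd_odd[of "t / 4" "7 * t / 4"] by simp
qed

lemma theta_uminus: "theta t {n. - n \<in> S} = theta t S"
  unfolding theta_def by (rule infsum_reindex_bij_witness[of _ uminus uminus]) auto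

lemma theta_scale:
  assumes "k \<noteq> 0"
  shows "theta t ((*) k ` S) = theta (t * (of_int k)\<^sup>2) S"
  unfolding theta_def using assms
  by (subst infsum_reindex) (auto simp: o_def inj_on_def power_mult_distrib mult_ac)

text \<open>The substitution is multiplication of Gaussian integers by \<open>2 - \<i>\<close>, an element of norm 5.\<close>

lemma theta_degree_5:
  assumes "t > 0"
  shows "(theta t UNIV)\<^sup>2 - (theta (5 * t) UNIV)\<^sup>2
    = 4 * theta (t / 5) {n. n mod 5 = 1} * theta (t / 5) {n. n mod 5 = 2}"
proof -
  define R where "R j = {n::int. n mod 5 = j}" for j
  have t5: "t / 5 > 0" using assms by simp
  let ?i = "\<lambda>(a, b). (2 * a + b, 2 * b - a :: int)"
  have "bij_betw ?i (UNIV \<times> UNIV) {(m, n). 5 dvd n - 2 * m}"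
  proof (rule bij_betw_imageI)
    show "?i ` (UNIV \<times> UNIV) = {(m, n). 5 dvd n - 2 * m}"
    proof safe
      fix m n :: int assume "5 dvd n - 2 * m"
      then obtain c where "n - 2 * m = 5 * c" by (elim dvdE)
      then have "(m, n) = ?i (- c, m + 2 * c)" by simp
      then show "(m, n) \<in> ?i ` (UNIV \<times> UNIV)" by blast
    qed auto
  qed (auto simp: inj_on_def)
  then have "theta_pair (t / 5) (t / 5) {(m, n). 5 dvd n - 2 * m} = theta_pair t t (UNIV \<times> UNIV)"
    by (rule theta_pair_reindex) (clarsimp, simp add: field_simps power2_eq_square)
  \<comment> \<open>Modulo 5 the image is the line \<open>n = 2 * m\<close>, hence a disjoint union
    of five products of residue classes. As 4 = -1 and 3 = -2 mod 5, the four products without the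
    class 0 have equal value.\<close>
  moreover have "{(m, n). 5 dvd n - 2 * m} = R 0 \<times> R 0 \<union> (R 1 \<times> R 2 \<union> (R 2 \<times> R 4 \<union> (R 3 \<times> R 1 \<union> R 4 \<times> R 3)))"
  proof -
    have "5 dvd n - 2 * m \<longleftrightarrow> m mod 5 = 0 \<and> n mod 5 = 0 \<or> m mod 5 = 1 \<and> n mod 5 = 2 \<or> m mod 5 = 2 \<and> n mod 5 = 4 \<or>
       m mod 5 = 3 \<and> n mod 5 = 1 \<or> m mod 5 = 4 \<and> n mod 5 = 3" for m n :: int
    proof -
      have "5 dvd n - 2 * m \<longleftrightarrow> n mod 5 = (2 * (m mod 5)) mod 5"
        by (metis mod_eq_dvd_iff mod_mult_right_eq)
      moreover have "m mod 5 = 0 \<or> m mod 5 = 1 \<or> m mod 5 = 2 \<or> m mod 5 = 3 \<or> m mod 5 = 4"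
        by presburger
      ultimately show ?thesis by (elim disjE) simp_all
    qed
    then show ?thesis unfolding R_def by (simp add: set_eq_iff)
  qed
  moreover have "theta_pair (t / 5) (t / 5) (R 0 \<times> R 0 \<union> (R 1 \<times> R 2 \<union> (R 2 \<times> R 4 \<union> (R 3 \<times> R 1 \<union> R 4 \<times> R 3))))
    = theta (t / 5) (R 0) * theta (t / 5) (R 0) +
      (theta (t / 5) (R 1) * theta (t / 5) (R 2) + (theta (t / 5) (R 2) * theta (t / 5) (R 4) +
      (theta (t / 5) (R 3) * theta (t / 5) (R 1) + theta (t / 5) (R 4) * theta (t / 5) (R 3))))"
  proof -
    have dis: "R i \<times> A \<inter> R j \<times> B = {}" if "i \<noteq> j" for i j A B
      using that unfolding R_def by auto
    show ?thesis
      unfolding theta_mult[OF t5 t5]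
      by (subst theta_pair_union[OF t5 t5], (simp add: Int_Un_distrib dis; fail))+ simp
  qed
  moreover have "theta (t / 5) (R 4) = theta (t / 5) (R 1)"
  proof -
    have "x mod 5 = 4 \<longleftrightarrow> (- x) mod 5 = 1" for x :: int by presburger
    then have "R 4 = {n. - n \<in> R 1}" by (simp add: R_def)
    then show ?thesis by (simp only: theta_uminus)
  qed
  moreover have "theta (t / 5) (R 3) = theta (t / 5) (R 2)"
  proof -
    have "x mod 5 = 3 \<longleftrightarrow> (- x) mod 5 = 2" for x :: int by presburger
    then have "R 3 = {n. - n \<in> R 2}" by (simp add: R_def)
    then show ?thesis by (simp only: theta_uminus)
  qed
  moreover have "theta (t / 5) (R 0) = theta (5 * t) UNIV"
  proof -
    have "R 0 = (*) 5 ` UNIV"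
    proof safe
      fix n assume "n \<in> R 0"
      then have "5 dvd n" by (simp add: R_def mod_eq_0_iff_dvd)
      then show "n \<in> (*) 5 ` UNIV" by (elim dvdE) simp
    qed (simp add: R_def)
    then show ?thesis using theta_scale[of 5 "t / 5" UNIV] by (simp only:) (simp add: mult.commute)
  qed
  moreover have "theta t UNIV * theta t UNIV = theta_pair t t (UNIV \<times> UNIV)"
    by (rule theta_mult[OF assms assms])
  ultimately show ?thesis
    unfolding R_def[symmetric] power2_eq_square by (simp only:) (simp add: algebra_simps)
qed

section \<open>The inversion formula\<close>

text \<open>Dominated convergence for series over the integers: Tannery's theorem, carried over
  along the enumeration \<open>int_decode\<close>.\<close>

lemma tannery_int:
  fixes f :: "nat \<Rightarrow> int \<Rightarrow> real"
  assumes lim: "\<And>k. (\<lambda>n. f n k) \<longlonglongrightarrow> g k"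
    and bound: "\<And>n k. n \<ge> N \<Longrightarrow> \<bar>f n k\<bar> \<le> M k"
    and M: "M summable_on UNIV"
  shows "(\<lambda>n. infsum (f n) UNIV) \<longlonglongrightarrow> infsum g UNIV"
proof -
  let ?d = int_decode
  have M': "(\<lambda>i. M (?d i)) summable_on UNIV"
    using summable_on_reindex_bij_betw[OF bij_int_decode, of M] M by simp
  have Ms: "summable (\<lambda>i. M (?d i))"
    using M' by (rule summable_on_imp_summable)
  have eq: "infsum h UNIV = suminf (\<lambda>i. h (?d i))" if h: "\<And>k. \<bar>h k\<bar> \<le> M k" for h
  proof -
    have "summable (\<lambda>i. norm (h (?d i)))"
      by (rule summable_comparison_test'[OF Ms, of 0]) (use h in auto)
    then have "(\<lambda>i. h (?d i)) summable_on UNIV"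
      by (rule norm_summable_imp_summable_on)
    then have "((\<lambda>i. h (?d i)) has_sum infsum (\<lambda>i. h (?d i)) UNIV) UNIV"
      by (rule has_sum_infsum)
    then have "(\<lambda>i. h (?d i)) sums infsum (\<lambda>i. h (?d i)) UNIV"
      by (rule has_sum_imp_sums)
    moreover have "infsum (\<lambda>i. h (?d i)) UNIV = infsum h UNIV"
      by (rule infsum_reindex_bij_betw[OF bij_int_decode])
    ultimately show ?thesis by (simp add: sums_iff)
  qed
  have g: "\<bar>g k\<bar> \<le> M k" for k
  proof (rule LIMSEQ_le_const2[OF tendsto_rabs[OF lim[of k]]])
    show "\<exists>N. \<forall>n\<ge>N. \<bar>f n k\<bar> \<le> M k" using bound by blast
  qed
  have "(\<lambda>n. suminf (\<lambda>i. f (n + N) (?d i))) \<longlonglongrightarrow> suminf (\<lambda>i. g (?d i))"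
  proof -
    have "((\<lambda>n. f (n + N) (?d i)) \<longlongrightarrow> g (?d i)) sequentially" for i
      by (rule LIMSEQ_ignore_initial_segment[OF lim])
    moreover have "eventually (\<lambda>(i, n). norm (f (n + N) (?d i)) \<le> M (?d i)) (at_top \<times>\<^sub>F sequentially)"
      by (rule always_eventually) (use bound in auto)
    ultimately show ?thesis
      using tannerys_theorem[of "\<lambda>i n. f (n + N) (?d i)" "\<lambda>i. g (?d i)" sequentially "\<lambda>i. M (?d i)"] Ms by auto
  qed
  then have "(\<lambda>n. infsum (f (n + N)) UNIV) \<longlonglongrightarrow> infsum g UNIV"
    using eq[of g] g eq[of "f (_ + N)"] bound by simp
  then show ?thesis by (rule LIMSEQ_offset)
qed

text \<open>Divided by \<open>4 ^ m\<close>, this is the coefficient of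
  \<open>cis (2 * k * x)\<close> in \<open>cos x ^ (2 * m)\<close>. The value 0 outside the range
  lets finite Fourier sums be written as sums over all integers.\<close>

definition central_binom :: "nat \<Rightarrow> int \<Rightarrow> real"
  where "central_binom m k = (if \<bar>k\<bar> \<le> int m then of_nat ((2 * m) choose nat (int m + k)) else 0)"

lemma central_binom_uminus: "central_binom m (- k) = central_binom m k"
proof (cases "\<bar>k\<bar> \<le> int m")
  case True
  have "2 * m choose nat (int m + - k) = 2 * m choose (2 * m - nat (int m + - k))"
    by (rule binomial_symmetric) (use True in auto)
  also have "2 * m - nat (int m + - k) = nat (int m + k)" using True by auto
  finally show ?thesis using True by (simp add: central_binom_def)
qed (simp add: central_binom_def)

text \<open>The quotient of neighbouring coefficients, written without division so that it also
  holds at and beyond the edge \<open>k = m\<close>.\<close>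

lemma central_binom_Suc:
  "central_binom m (int (Suc k)) * (real m + real k + 1) = central_binom m (int k) * (real m - real k)"
proof (cases "k \<le> m")
  case True
  have "Suc (m + k) * (2 * m choose Suc (m + k)) = (2 * m choose (m + k)) * (2 * m - (m + k))"
    using binomial_absorb_comp[of "2 * m" "m + k"] binomial_absorption[of "m + k" "2 * m"]
    by (simp add: mult.commute)
  also have "2 * m - (m + k) = m - k" by simp
  finally have "real (Suc (m + k) * (2 * m choose Suc (m + k))) = real ((2 * m choose (m + k)) * (m - k))"
    by (rule arg_cong)
  then have *: "(real m + real k + 1) * real (2 * m choose Suc (m + k)) = real (2 * m choose (m + k)) * (real m - real k)"
    using True by (simp add: of_nat_diff algebra_simps)
  have 1: "nat (int m + int (Suc k)) = Suc (m + k)" "nat (int m + int k) = m + k" by auto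
  show ?thesis
  proof (cases "k = m")
    case True then show ?thesis by (simp add: central_binom_def)
  next
    case False
    then show ?thesis unfolding central_binom_def 1 using * True by (simp add: mult.commute)
  qed
qed (simp add: central_binom_def)

lemma central_binom_nonneg: "central_binom m k \<ge> 0"
  by (simp add: central_binom_def)

text \<open>Each quotient is \<open>1 - (2 * k + 1) / (m + k + 1)\<close>, at most
  \<open>exp (- (2 * k + 1) / (m + K))\<close>, and the odd numbers add up to squares. A fixed K
  keeps one denominator throughout the induction.\<close>

lemma central_binom_le:
  assumes "k \<le> K" "m > 0"
  shows "central_binom m (int k) \<le> central_binom m 0 * exp (- (real k)\<^sup>2 / (real m + real K))"
  using assms(1)
proof (induction k)
  case (Suc k)
  have pos: "real m + real k + 1 > 0" "real m + real K > 0" using assms by auto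
  show ?case
  proof (cases "k < m")
    case True
    have "central_binom m (int (Suc k)) = central_binom m (int k) * ((real m - real k) / (real m + real k + 1))"
      using central_binom_Suc[of m k] pos by (simp add: field_simps)
    also have "\<dots> \<le> (central_binom m 0 * exp (- (real k)\<^sup>2 / (real m + real K))) * exp (- (2 * real k + 1) / (real m + real K))"
    proof (rule mult_mono)
      have "(real m - real k) / (real m + real k + 1) = 1 + - (2 * real k + 1) / (real m + real k + 1)"
        using pos by (simp add: field_simps)
      also have "\<dots> \<le> exp (- (2 * real k + 1) / (real m + real k + 1))"
        by (rule exp_ge_add_one_self)
      also have "\<dots> \<le> exp (- (2 * real k + 1) / (real m + real K))"
      proof -
        have "(2 * real k + 1) / (real m + real K) \<le> (2 * real k + 1) / (real m + real k + 1)"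
          using pos Suc.prems by (intro divide_left_mono) auto
        then show ?thesis by (simp only: exp_le_cancel_iff minus_divide_left[symmetric] neg_le_iff_le)
      qed
      finally show "(real m - real k) / (real m + real k + 1) \<le> exp (- (2 * real k + 1) / (real m + real K))" .
    qed (use Suc True central_binom_nonneg in auto)
    also have "\<dots> = central_binom m 0 * exp (- (real (Suc k))\<^sup>2 / (real m + real K))"
      by (simp flip: exp_add add_divide_distrib add: power2_eq_square algebra_simps)
    finally show ?thesis .
  qed (simp add: central_binom_def)
qed simp

text \<open>The reciprocal quotient is \<open>1 + (2 * k + 1) / (m - k)\<close>, and
  \<open>m - k >= m - K + 1\<close> below K; the same telescoping then gives a lower bound.\<close>

lemma central_binom_ge:
  assumes "k \<le> K" "K \<le> m"
  shows "central_binom m (int k) \<ge> central_binom m 0 * exp (- (real k)\<^sup>2 / (real m - real K + 1))"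
  using assms(1)
proof (induction k)
  case (Suc k)
  have pos: "real m - real k > 0" "real m - real K + 1 > 0" "real m + real k + 1 > 0" using assms Suc.prems by auto
  have "central_binom m 0 * exp (- (real (Suc k))\<^sup>2 / (real m - real K + 1)) =
      (central_binom m 0 * exp (- (real k)\<^sup>2 / (real m - real K + 1))) * exp (- (2 * real k + 1) / (real m - real K + 1))"
    by (simp flip: exp_add add_divide_distrib add: power2_eq_square algebra_simps)
  also have "\<dots> \<le> central_binom m (int k) * ((real m - real k) / (real m + real k + 1))"
  proof (rule mult_mono)
    have "(real m + real k + 1) / (real m - real k) = 1 + (2 * real k + 1) / (real m - real k)"
      using pos by (simp add: field_simps)
    also have "\<dots> \<le> exp ((2 * real k + 1) / (real m - real k))"
      by (rule exp_ge_add_one_self)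
    also have "\<dots> \<le> exp ((2 * real k + 1) / (real m - real K + 1))"
      using pos Suc.prems by (simp add: divide_left_mono)
    finally have "1 / exp ((2 * real k + 1) / (real m - real K + 1)) \<le> 1 / ((real m + real k + 1) / (real m - real k))"
      using pos by (intro divide_left_mono) auto
    then show "exp (- (2 * real k + 1) / (real m - real K + 1)) \<le> (real m - real k) / (real m + real k + 1)"
      by (simp only: minus_divide_left[symmetric] exp_minus inverse_eq_divide) simp
  qed (use Suc central_binom_nonneg in auto)
  also have "\<dots> = central_binom m (int (Suc k))"
    using central_binom_Suc[of m k] pos by (simp add: field_simps)
  finally show ?case .
qed simp

section \<open>Sampling powers of the cosine\<close>

lemma cos_power_expansion:
  "complex_of_real (cos x ^ (2 * m)) = (\<Sum>k = - int m..int m. of_real (central_binom m k) * cis (2 * of_int k * x)) / 4 ^ m"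
proof -
  have e: "complex_of_real (cos x) = (cis x + cis (- x)) / 2"
    by (simp add: complex_eq_iff)
  have "complex_of_real (cos x ^ (2 * m)) = (cis x + cis (- x)) ^ (2 * m) / 4 ^ m"
    unfolding of_real_power e power_divide by (simp add: power_mult)
  also have "(cis x + cis (- x)) ^ (2 * m) = (\<Sum>r\<le>2 * m. of_nat (2 * m choose r) * cis x ^ r * cis (- x) ^ (2 * m - r))"
    by (rule binomial_ring)
  also have "\<dots> = (\<Sum>k = - int m..int m. of_real (central_binom m k) * cis (2 * of_int k * x))"
  proof (rule sum.reindex_bij_witness[of _ "\<lambda>k. nat (int m + k)" "\<lambda>r. int r - int m"])
    fix r assume r: "r \<in> {..2 * m}"
    have "cis x ^ r * cis (- x) ^ (2 * m - r) = cis (2 * of_int (int r - int m) * x)"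
      unfolding Complex.DeMoivre cis_mult
      by (intro arg_cong[of _ _ cis]) (use r in \<open>simp add: of_nat_diff algebra_simps\<close>)
    then show "of_real (central_binom m (int r - int m)) * cis (2 * of_int (int r - int m) * x)
        = of_nat (2 * m choose r) * cis x ^ r * cis (- x) ^ (2 * m - r)"
      using r by (simp add: central_binom_def mult.assoc)
  qed auto
  finally show ?thesis .
qed

text \<open>Orthogonality of the roots of unity of order \<open>2 * p\<close>. The offset a of the
  sample points contributes only a phase, which becomes the cosine weight in the inversion
  formula.\<close>

lemma sum_cis_period:
  fixes p :: nat and k :: int and a :: real
  assumes "p > 0"
  shows "(\<Sum>j = - int p..<int p. cis (2 * of_int k * (pi * (of_int j + a) / (2 * real p))))
    = (if 2 * int p dvd k then of_nat (2 * p) * cis (2 * pi * a * of_int k / (2 * real p)) else 0)"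
proof -
  define z where "z = cis (2 * pi * of_int k / (2 * real p))"
  define w where "w = cis (2 * of_int k * (pi * (a - real p) / (2 * real p)))"
  have "(\<Sum>j = - int p..<int p. cis (2 * of_int k * (pi * (of_int j + a) / (2 * real p)))) = (\<Sum>i<2 * p. w * z ^ i)"
  proof (rule sum.reindex_bij_witness[of _ "\<lambda>i. int i - int p" "\<lambda>j. nat (j + int p)"])
    fix j assume j: "j \<in> {- int p..<int p}"
    have "real (nat (j + int p)) = of_int j + real p" using j by simp
    then show "w * z ^ nat (j + int p) = cis (2 * of_int k * (pi * (of_int j + a) / (2 * real p)))"
      unfolding w_def z_def Complex.DeMoivre cis_mult
      by (intro arg_cong[of _ _ cis]) (use assms in \<open>simp add: field_simps\<close>)
  qed auto
  also have "\<dots> = w * (\<Sum>i<2 * p. z ^ i)"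
    by (simp add: sum_distrib_left)
  also have "\<dots> = (if 2 * int p dvd k then of_nat (2 * p) * cis (2 * pi * a * of_int k / (2 * real p)) else 0)"
  proof (cases "2 * int p dvd k")
    case True
    then obtain c where c: "k = 2 * int p * c" by (elim dvdE)
    have z1: "z = 1"
    proof -
      have "2 * pi * real_of_int k / (2 * real p) = 2 * pi * of_int c"
        unfolding c using assms by simp
      then show ?thesis unfolding z_def by (simp only: cis_multiple_2pi Ints_of_int)
    qed
    have "w = cis (2 * pi * a * of_int k / (2 * real p)) * cis (2 * pi * (- of_int c * real p))"
      unfolding w_def cis_mult c by (intro arg_cong[of _ _ cis]) (use assms in \<open>simp add: field_simps\<close>)
    also have "cis (2 * pi * (- of_int c * real p)) = 1"
      by (rule cis_multiple_2pi) simp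
    finally show ?thesis using True z1 by simp
  next
    case False
    have "z \<noteq> 1"
    proof
      assume "z = 1"
      then have "cos (2 * pi * of_int k / (2 * real p)) = 1"
        unfolding z_def by (metis cis.simps(1) one_complex.simps(1))
      then obtain n :: int where "2 * pi * of_int k / (2 * real p) = of_int n * 2 * pi"
        using cos_one_2pi_int by blast
      then have "real_of_int k = real_of_int (2 * int p * n)"
        using assms by (simp add: field_simps)
      then have "k = 2 * int p * n" by (simp only: of_int_eq_iff)
      then show False using False by simp
    qed
    moreover have "z ^ (2 * p) = 1"
    proof -
      have "real (2 * p) * (2 * pi * real_of_int k / (2 * real p)) = 2 * pi * of_int k"
        using assms by simp
      then show ?thesis unfolding z_def Complex.DeMoivre by (simp only: cis_multiple_2pi Ints_of_int)
    qed
    ultimately show ?thesis using False by (simp add: geometric_sum)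
  qed
  finally show ?thesis .
qed

text \<open>A finite Poisson summation formula: sampling at \<open>2 * p\<close> equidistant points
  annihilates every frequency not divisible by \<open>2 * p\<close>. The sum on the right has finite
  support.\<close>

lemma sum_cos_power:
  fixes p m :: nat and a :: real
  assumes "p > 0"
  shows "(\<Sum>j = - int p..<int p. cos (pi * (of_int j + a) / (2 * real p)) ^ (2 * m))
    = real (2 * p) / 4 ^ m * (\<Sum>\<^sub>\<infinity>k. central_binom m (2 * int p * k) * cos (2 * pi * a * of_int k))"
proof -
  define S where "S = {k. \<bar>2 * int p * k\<bar> \<le> int m}"
  have "complex_of_real (\<Sum>j = - int p..<int p. cos (pi * (of_int j + a) / (2 * real p)) ^ (2 * m))
    = (\<Sum>j = - int p..<int p. \<Sum>k = - int m..int m. of_real (central_binom m k) *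
         cis (2 * of_int k * (pi * (of_int j + a) / (2 * real p)))) / 4 ^ m"
    unfolding of_real_sum cos_power_expansion sum_divide_distrib ..
  also have "\<dots> = (\<Sum>k = - int m..int m. of_real (central_binom m k) *
       (if 2 * int p dvd k then of_nat (2 * p) * cis (2 * pi * a * of_int k / (2 * real p)) else 0)) / 4 ^ m"
    by (subst sum.swap) (simp only: sum_distrib_left[symmetric] sum_cis_period[OF assms])
  also have "(\<Sum>k = - int m..int m. of_real (central_binom m k) *
       (if 2 * int p dvd k then of_nat (2 * p) * cis (2 * pi * a * of_int k / (2 * real p)) else 0))
     = (\<Sum>k\<in>{k \<in> {- int m..int m}. 2 * int p dvd k}. of_real (central_binom m k) *
       (of_nat (2 * p) * cis (2 * pi * a * of_int k / (2 * real p))))"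
    by (subst sum.inter_filter) (auto intro: sum.cong)
  also have "\<dots> = (\<Sum>k\<in>S. of_real (central_binom m (2 * int p * k)) * (of_nat (2 * p) * cis (2 * pi * a * of_int k)))"
  proof (rule sum.reindex_bij_witness[of _ "\<lambda>k. 2 * int p * k" "\<lambda>k. k div (2 * int p)"])
    fix k assume "k \<in> {k \<in> {- int m..int m}. 2 * int p dvd k}"
    then have "2 * int p dvd k" "\<bar>k\<bar> \<le> int m" by auto
    then obtain c where "k = 2 * int p * c" "\<bar>k\<bar> \<le> int m" by (elim dvdE)
    then show "2 * int p * (k div (2 * int p)) = k" "k div (2 * int p) \<in> S"
      "of_real (central_binom m (2 * int p * (k div (2 * int p)))) * (of_nat (2 * p) * cis (2 * pi * a * of_int (k div (2 * int p))))
       = of_real (central_binom m k) * (of_nat (2 * p) * cis (2 * pi * a * of_int k / (2 * real p)))"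
      using assms by (simp_all add: S_def mult.assoc)
  qed (use assms in \<open>auto simp: S_def\<close>)
  finally have "(\<Sum>j = - int p..<int p. cos (pi * (of_int j + a) / (2 * real p)) ^ (2 * m))
    = Re ((\<Sum>k\<in>S. of_real (central_binom m (2 * int p * k)) * (of_nat (2 * p) * cis (2 * pi * a * of_int k))) / 4 ^ m)"
    by (metis Re_complex_of_real)
  also have "\<dots> = real (2 * p) / 4 ^ m * (\<Sum>k\<in>S. central_binom m (2 * int p * k) * cos (2 * pi * a * of_int k))"
  proof -
    have "(4 :: complex) ^ m = of_real (4 ^ m)" by simp
    then show ?thesis
      by (simp add: Re_divide_of_real sum_distrib_left sum_divide_distrib mult_ac del: of_real_power of_real_numeral)
  qed
  also have "finite S"
  proof (rule finite_subset)
    show "S \<subseteq> {- int m..int m}"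
    proof
      fix k assume "k \<in> S"
      then have "\<bar>2 * int p\<bar> * \<bar>k\<bar> \<le> int m" by (simp add: S_def abs_mult)
      moreover have "1 * \<bar>k\<bar> \<le> \<bar>2 * int p\<bar> * \<bar>k\<bar>" by (rule mult_right_mono) (use assms in auto)
      ultimately show "k \<in> {- int m..int m}" by auto
    qed
  qed simp
  then have "(\<Sum>k\<in>S. central_binom m (2 * int p * k) * cos (2 * pi * a * of_int k))
      = (\<Sum>\<^sub>\<infinity>k\<in>S. central_binom m (2 * int p * k) * cos (2 * pi * a * of_int k))" by simp
  also have "\<dots> = (\<Sum>\<^sub>\<infinity>k. central_binom m (2 * int p * k) * cos (2 * pi * a * of_int k))"
    by (rule infsum_cong_neutral) (auto simp: S_def central_binom_def)
  finally show ?thesis .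
qed

text \<open>The n-th partial Wallis product is exactly the reciprocal of the n-th term here, by
  induction on the quotient of successive central coefficients.\<close>

lemma central_binom_wallis:
  "(\<lambda>m. (2 * real m + 1) * (central_binom m 0 / 4 ^ m)\<^sup>2) \<longlonglongrightarrow> 2 / pi"
proof -
  have rec: "central_binom (Suc n) 0 = central_binom n 0 * (2 * (2 * real n + 1) / (real n + 1))" for n
  proof -
    have c: "central_binom k 0 = fact (2 * k) / (fact k * fact k)" for k
      by (simp add: central_binom_def binomial_fact)
    have "real n + 1 \<noteq> 0" by linarith
    moreover have "fact (2 * Suc n) = (2 * (real n + 1)) * (2 * real n + 1) * fact (2 * n)"
      "fact (Suc n) = (real n + 1) * fact n"
      by (simp_all add: algebra_simps)
    ultimately show ?thesis
      unfolding c by (simp add: divide_simps del: fact_Suc) (simp add: algebra_simps)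
  qed
  have "(\<Prod>k=1..n. (4 * real k ^ 2) / (4 * real k ^ 2 - 1)) =
      inverse ((2 * real n + 1) * (central_binom n 0 / 4 ^ n)\<^sup>2)" for n
  proof (induction n)
    case (Suc n)
    define c where "c = central_binom n 0"
    have c: "c \<noteq> 0" by (simp add: c_def central_binom_def)
    define x where "x = real n"
    have x: "x \<ge> 0" by (simp add: x_def)
    have e: "4 * (x + 1)\<^sup>2 - 1 = (2 * x + 1) * (2 * x + 3)"
      by (simp add: power2_eq_square algebra_simps)
    have "inverse ((2 * x + 1) * (c / 4 ^ n)\<^sup>2) * (4 * (x + 1)\<^sup>2 / (4 * (x + 1)\<^sup>2 - 1))
       = inverse ((2 * (x + 1) + 1) * (c * (2 * (2 * x + 1) / (x + 1)) / (4 * 4 ^ n))\<^sup>2)"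
      unfolding e using x c by (simp add: divide_simps power2_eq_square) (simp add: algebra_simps)
    then show ?case
      using Suc by (simp add: rec c_def x_def add.commute)
  qed (simp add: central_binom_def)
  then have "(\<lambda>n. inverse ((2 * real n + 1) * (central_binom n 0 / 4 ^ n)\<^sup>2)) \<longlonglongrightarrow> pi / 2"
    using wallis by simp
  then have "(\<lambda>n. inverse (inverse ((2 * real n + 1) * (central_binom n 0 / 4 ^ n)\<^sup>2))) \<longlonglongrightarrow> inverse (pi / 2)"
    by (rule tendsto_inverse) simp
  then show ?thesis by simp
qed

text \<open>\<open>cos y * exp (y^2 / 2)\<close> decreases on \<open>[0, pi / 2]\<close>, its
  derivative having the sign of \<open>y * cos y - sin y\<close>. The bound covers all sample
  points, so it yields a majorant and not only a limit.\<close>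

lemma cos_le_exp_neg_sq:
  assumes "\<bar>x\<bar> \<le> pi / 2"
  shows "cos x \<le> exp (- x\<^sup>2 / 2)"
proof -
  define y where "y = \<bar>x\<bar>"
  have y: "0 \<le> y" "y \<le> pi / 2" using assms by (auto simp: y_def)
  have 1: "z * cos z \<le> sin z" if "0 \<le> z" "z \<le> pi / 2" for z
  proof -
    have "sin 0 - 0 * cos 0 \<le> sin z - z * cos z"
    proof (rule DERIV_nonneg_imp_nondecreasing[OF that(1)])
      fix w assume w: "0 \<le> w" "w \<le> z"
      have "((\<lambda>z. sin z - z * cos z) has_real_derivative w * sin w) (at w)"
        by (auto intro!: derivative_eq_intros)
      moreover have "w * sin w \<ge> 0"
        using w that by (intro mult_nonneg_nonneg sin_ge_zero) auto
      ultimately show "\<exists>d. ((\<lambda>z. sin z - z * cos z) has_real_derivative d) (at w) \<and> 0 \<le> d" by blast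
    qed
    then show ?thesis by simp
  qed
  have "cos y * exp (y\<^sup>2 / 2) \<le> cos 0 * exp (0\<^sup>2 / 2)"
  proof (rule DERIV_nonpos_imp_nonincreasing[OF y(1)])
    fix z assume z: "0 \<le> z" "z \<le> y"
    have "((\<lambda>y. cos y * exp (y\<^sup>2 / 2)) has_real_derivative (z * cos z - sin z) * exp (z\<^sup>2 / 2)) (at z)"
      by (auto intro!: derivative_eq_intros simp: algebra_simps)
    moreover have "(z * cos z - sin z) * exp (z\<^sup>2 / 2) \<le> 0"
      using 1[of z] z y by (simp add: mult_le_0_iff)
    ultimately show "\<exists>d. ((\<lambda>y. cos y * exp (y\<^sup>2 / 2)) has_real_derivative d) (at z) \<and> d \<le> 0" by blast
  qed
  then have "cos y \<le> 1 / exp (y\<^sup>2 / 2)" by (simp add: field_simps)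
  then show ?thesis by (simp add: y_def exp_minus inverse_eq_divide)
qed

text \<open>Together with \<open>1 - x^2 / 2 <= cos x\<close> this bounds the cosine from below by a
  Gaussian, up to a factor \<open>1 / (1 - u)\<close> in the exponent that tends to 1 with u tending
  to 0.\<close>

lemma exp_le_one_minus:
  assumes "u < 1"
  shows "exp (- (u / (1 - u))) \<le> 1 - (u :: real)"
proof -
  have "1 / (1 - u) = 1 + u / (1 - u)" using assms by (simp add: field_simps)
  also have "\<dots> \<le> exp (u / (1 - u))" by (rule exp_ge_add_one_self)
  finally show ?thesis using assms by (simp add: exp_minus field_simps)
qed

lemma cos_ge_one_minus: "1 - x\<^sup>2 / 2 \<le> cos (x :: real)"
proof -
  have "cos x = 1 - 2 * (sin (x / 2))\<^sup>2"
    using cos_double_sin[of "x / 2"] by simp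
  moreover have "(sin (x / 2))\<^sup>2 \<le> (x / 2)\<^sup>2"
    using abs_sin_x_le_abs_x[of "x / 2"] abs_le_square_iff by blast
  ultimately show ?thesis by (simp add: power_divide)
qed

text \<open>
  Polya's proof: let \<open>L = 2 * p\<close> tend to infinity in \<open>sum_cos_power\<close> with the exponent \<open>m\<close> chosen such that
  \<open>L\<^sup>2 / m\<close> tends to \<open>pi * t\<close>. Powers of the cosine on one side and binomial coefficients on the other become Gaussians,
  and Wallis' product supplies the factor \<open>sqrt t\<close>.
\<close>

lemma theta_inversion_limit:
  fixes a t :: real
  assumes t: "t > 0" and a: "0 \<le> a" "a \<le> 1 / 2"
  shows "(\<Sum>\<^sub>\<infinity>j::int. exp (- (pi / t) * (of_int j + a)\<^sup>2))
    = sqrt t * (\<Sum>\<^sub>\<infinity>k::int. exp (- pi * t * (of_int k)\<^sup>2) * cos (2 * pi * a * of_int k))"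
proof -
  define D where "D = pi * t"
  have D: "D > 0" using t by (simp add: D_def)
  define p where "p n = Suc n" for n :: nat
  define L where "L n = 2 * real (p n)" for n
  \<comment> \<open>Rounding up makes \<open>m n / (L n)^2 >= 1 / D\<close> for every n, so the
    limiting Gaussian itself dominates the cosine powers; the upper bound \<open>1 / D + 1\<close>
    on this ratio serves the binomial side.\<close>
  define m where "m n = nat \<lceil>(L n)\<^sup>2 / D\<rceil>" for n
  define r where "r n = real (m n) / (L n)\<^sup>2" for n
  have L: "L n \<ge> 1" for n by (simp add: L_def p_def)
  have Linf: "filterlim L at_top sequentially"
    unfolding L_def p_def
    by (intro filterlim_tendsto_pos_mult_at_top[OF tendsto_const] filterlim_compose[OF filterlim_real_sequentially] filterlim_Suc) simp
  have Li: "(\<lambda>n. c / L n) \<longlonglongrightarrow> 0" for c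
    by (rule real_tendsto_divide_at_top[OF tendsto_const Linf])
  have m_bounds: "(L n)\<^sup>2 / D \<le> real (m n)" "real (m n) \<le> (L n)\<^sup>2 / D + 1" for n
    unfolding m_def using D by (simp_all add: of_nat_ceiling)
  have r_ge: "r n \<ge> 1 / D" for n
    using m_bounds(1)[of n] L[of n] D by (simp add: r_def field_simps)
  have r_le': "r n \<le> 1 / D + (1 / L n)\<^sup>2" for n
  proof -
    have "r n \<le> ((L n)\<^sup>2 / D + 1) / (L n)\<^sup>2"
      unfolding r_def by (intro divide_right_mono m_bounds) simp
    also have "\<dots> = 1 / D + (1 / L n)\<^sup>2"
      using L[of n] by (simp add: add_divide_distrib power_divide)
    finally show ?thesis .
  qed
  have r_le: "r n \<le> 1 / D + 1" for n
  proof -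
    have "(1 / L n)\<^sup>2 \<le> 1" using L[of n] by (intro power_le_one) auto
    then show ?thesis using r_le'[of n] by linarith
  qed
  have r_pos: "r n > 0" for n using r_ge[of n] D less_le_trans[of 0 "1 / D" "r n"] by simp
  have m_eq: "real (m n) = r n * (L n)\<^sup>2" for n
    using L[of n] by (simp add: r_def)
  have m_pos: "m n > 0" for n
  proof -
    have "r n * (L n)\<^sup>2 > 0" using r_pos[of n] L[of n] by simp
    then show ?thesis using m_eq[of n] by simp
  qed
  have r_lim: "r \<longlonglongrightarrow> 1 / D"
  proof (rule tendsto_sandwich[of "\<lambda>_. 1 / D" _ _ "\<lambda>n. 1 / D + (1 / L n)\<^sup>2"])
    have "(\<lambda>n. 1 / D + (1 / L n)\<^sup>2) \<longlonglongrightarrow> 1 / D + 0\<^sup>2"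
      by (intro tendsto_intros Li)
    then show "(\<lambda>n. 1 / D + (1 / L n)\<^sup>2) \<longlonglongrightarrow> 1 / D" by simp
  qed (use r_ge r_le' in auto)

  \<comment> \<open>The finite formula extended to all integers: f holds the cosine samples, g the
    binomial terms normalised to 1 at \<open>k = 0\<close>, and w the remaining prefactor.\<close>
  define f where "f n j = (if j \<in> {- int (p n)..<int (p n)} then cos (pi * (of_int j + a) / L n) ^ (2 * m n) else 0)" for n j
  define g where "g n k = central_binom (m n) (2 * int (p n) * k) / central_binom (m n) 0 * cos (2 * pi * a * of_int k)" for n k
  define w where "w n = L n / 4 ^ m n * central_binom (m n) 0" for n

  have f_upper: "f n j \<le> exp (- (r n * (pi * (of_int j + a))\<^sup>2))" "f n j \<ge> 0" for n j
  proof -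
    have "0 \<le> f n j \<and> f n j \<le> exp (- (r n * (pi * (of_int j + a))\<^sup>2))"
    proof (cases "j \<in> {- int (p n)..<int (p n)}")
      case True
      define x where "x = pi * (of_int j + a) / L n"
      have "- real (p n) \<le> of_int j" "real_of_int j + 1 \<le> real (p n)" using True by auto
      then have "\<bar>of_int j + a\<bar> \<le> real (p n)" using a by auto
      then have "pi * \<bar>of_int j + a\<bar> / L n \<le> pi * real (p n) / L n"
        using L[of n] by (intro divide_right_mono mult_left_mono) auto
      moreover have "pi * real (p n) / L n = pi / 2" by (simp add: L_def p_def field_simps)
      ultimately have x: "\<bar>x\<bar> \<le> pi / 2"
        using L[of n] by (simp add: x_def abs_mult)
      have "0 \<le> cos x" using x by (intro cos_ge_zero) auto
      then have "cos x ^ (2 * m n) \<le> exp (- x\<^sup>2 / 2) ^ (2 * m n)"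
        by (intro power_mono cos_le_exp_neg_sq x)
      also have "\<dots> = exp (real (2 * m n) * (- x\<^sup>2 / 2))" by (rule exp_of_nat_mult[symmetric])
      also have "real (2 * m n) * (- x\<^sup>2 / 2) = - (r n * (pi * (of_int j + a))\<^sup>2)"
        using L[of n] by (simp add: x_def m_eq power_divide)
      finally show ?thesis using True \<open>0 \<le> cos x\<close> by (simp add: f_def x_def)
    qed (auto simp: f_def)
    then show "f n j \<le> exp (- (r n * (pi * (of_int j + a))\<^sup>2))" "f n j \<ge> 0" by auto
  qed
  have lim_f: "(\<lambda>n. infsum (f n) UNIV) \<longlonglongrightarrow> infsum (\<lambda>j. exp (- (pi / t) * (of_int j + a)\<^sup>2)) UNIV"
  proof (rule tannery_int[where N = 0 and M = "\<lambda>j. exp (pi / t * \<bar>of_int j\<bar> - pi / t * (of_int j)\<^sup>2)"])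
    fix j :: int
    define y where "y = pi * (of_int j + a)"
    \<comment> \<open>\<open>u n\<close> is half the square of the argument \<open>y / L n\<close>
      of the cosine, and \<open>2 * m n * u n = r n * y^2\<close>.\<close>
    define u where "u n = y\<^sup>2 / (2 * (L n)\<^sup>2)" for n
    have u: "u \<longlonglongrightarrow> 0"
    proof -
      have "(\<lambda>n. (y / L n)\<^sup>2 / 2) \<longlonglongrightarrow> 0\<^sup>2 / 2" by (intro tendsto_intros Li) simp
      then show ?thesis by (simp add: u_def[abs_def] power_divide mult.commute)
    qed
    have e: "exp (- (pi / t) * (of_int j + a)\<^sup>2) = exp (- (1 / D * y\<^sup>2))"
      using t by (simp add: D_def y_def power_mult_distrib power2_eq_square)
    show "(\<lambda>n. f n j) \<longlonglongrightarrow> exp (- (pi / t) * (of_int j + a)\<^sup>2)"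
      unfolding e
    proof (rule tendsto_sandwich[of "\<lambda>n. exp (- (r n * y\<^sup>2 / (1 - u n)))" _ _ "\<lambda>n. exp (- (r n * y\<^sup>2))"])
      show "(\<lambda>n. exp (- (r n * y\<^sup>2))) \<longlonglongrightarrow> exp (- (1 / D * y\<^sup>2))"
        by (intro tendsto_intros r_lim)
      show "eventually (\<lambda>n. f n j \<le> exp (- (r n * y\<^sup>2))) sequentially"
        using f_upper(1) by (simp add: y_def)
      have "(\<lambda>n. exp (- (r n * y\<^sup>2 / (1 - u n)))) \<longlonglongrightarrow> exp (- (1 / D * y\<^sup>2 / (1 - 0)))"
        by (intro tendsto_intros r_lim u) simp
      then show "(\<lambda>n. exp (- (r n * y\<^sup>2 / (1 - u n)))) \<longlonglongrightarrow> exp (- (1 / D * y\<^sup>2))" by simp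
      have "eventually (\<lambda>n. u n < 1) sequentially" using order_tendstoD(2)[OF u, of 1] by simp
      moreover have "eventually (\<lambda>n. L n \<ge> 2 * (\<bar>of_int j\<bar> + 1)) sequentially"
        using Linf by (simp add: filterlim_at_top)
      ultimately show "eventually (\<lambda>n. exp (- (r n * y\<^sup>2 / (1 - u n))) \<le> f n j) sequentially"
      proof eventually_elim
        case (elim n)
        have "real (p n) \<ge> of_int (\<bar>j\<bar> + 1)" using elim(2) by (simp add: L_def)
        then have "\<bar>j\<bar> + 1 \<le> int (p n)" by linarith
        then have j: "j \<in> {- int (p n)..<int (p n)}" by auto
        have "exp (- (r n * y\<^sup>2 / (1 - u n))) = exp (real (2 * m n) * - (u n / (1 - u n)))"
          using L[of n] by (simp add: u_def m_eq)
        also have "\<dots> = exp (- (u n / (1 - u n))) ^ (2 * m n)" by (rule exp_of_nat_mult)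
        also have "\<dots> \<le> cos (y / L n) ^ (2 * m n)"
        proof (rule power_mono)
          have "exp (- (u n / (1 - u n))) \<le> 1 - u n" by (rule exp_le_one_minus) fact
          also have "\<dots> \<le> cos (y / L n)" using cos_ge_one_minus[of "y / L n"] by (simp add: u_def power_divide mult.commute)
          finally show "exp (- (u n / (1 - u n))) \<le> cos (y / L n)" .
        qed simp
        finally show ?case using j by (simp add: f_def y_def)
      qed
    qed
  next
    fix n :: nat and j :: int
    have "f n j \<le> exp (- (r n * (pi * (of_int j + a))\<^sup>2))" by (rule f_upper)
    also have "\<dots> \<le> exp (- (1 / D * (pi * (of_int j + a))\<^sup>2))"
      using mult_right_mono[OF r_ge[of n], of "(pi * (of_int j + a))\<^sup>2"] by simp
    also have "1 / D * (pi * (of_int j + a))\<^sup>2 = pi / t * (of_int j + a)\<^sup>2"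
      using t by (simp add: D_def power_mult_distrib power2_eq_square)
    also have "exp (- (pi / t * (of_int j + a)\<^sup>2)) \<le> exp (pi / t * \<bar>of_int j\<bar> - pi / t * (of_int j)\<^sup>2)"
    proof -
      \<comment> \<open>Here \<open>a <= 1 / 2\<close> enters: the cross term of the square costs at
        most |j|.\<close>
      have "- \<bar>real_of_int j\<bar> \<le> 2 * a * of_int j"
      proof -
        have "\<bar>2 * a * of_int j\<bar> \<le> 1 * \<bar>real_of_int j\<bar>"
          unfolding abs_mult using a by (intro mult_right_mono) auto
        then show ?thesis by linarith
      qed
      moreover have "(of_int j + a)\<^sup>2 = (of_int j)\<^sup>2 + 2 * a * of_int j + a\<^sup>2"
        by (simp add: power2_sum)
      ultimately have "(of_int j)\<^sup>2 - \<bar>of_int j\<bar> \<le> (of_int j + a)\<^sup>2" using zero_le_power2[of a] by linarith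
      then have "pi / t * ((of_int j)\<^sup>2 - \<bar>of_int j\<bar>) \<le> pi / t * (of_int j + a)\<^sup>2"
        using t by (intro mult_left_mono) auto
      then show ?thesis by (simp add: right_diff_distrib)
    qed
    finally show "\<bar>f n j\<bar> \<le> exp (pi / t * \<bar>of_int j\<bar> - pi / t * (of_int j)\<^sup>2)"
      using f_upper(2)[of n j] by simp
  next
    show "(\<lambda>j::int. exp (pi / t * \<bar>of_int j\<bar> - pi / t * (of_int j)\<^sup>2)) summable_on UNIV"
      using t by (intro summable_on_int_gauss) auto
  qed
  have fg: "infsum (f n) UNIV = w n * infsum (g n) UNIV" for n
  proof -
    have "infsum (f n) UNIV = infsum (f n) {- int (p n)..<int (p n)}"
      by (rule infsum_cong_neutral) (auto simp: f_def)
    also have "\<dots> = (\<Sum>j = - int (p n)..<int (p n). cos (pi * (of_int j + a) / (2 * real (p n))) ^ (2 * m n))"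
      by (simp add: f_def L_def)
    also have "\<dots> = real (2 * p n) / 4 ^ m n * (\<Sum>\<^sub>\<infinity>k. central_binom (m n) (2 * int (p n) * k) * cos (2 * pi * a * of_int k))"
      by (rule sum_cos_power) (simp add: p_def)
    also have "(\<lambda>k. central_binom (m n) (2 * int (p n) * k) * cos (2 * pi * a * of_int k)) = (\<lambda>k. central_binom (m n) 0 * g n k)"
    proof
      have "central_binom (m n) 0 \<noteq> 0" by (simp add: central_binom_def)
      then show "central_binom (m n) (2 * int (p n) * k) * cos (2 * pi * a * of_int k) = central_binom (m n) 0 * g n k" for k
        by (simp add: g_def)
    qed
    also have "infsum (\<lambda>k. central_binom (m n) 0 * g n k) UNIV = central_binom (m n) 0 * infsum (g n) UNIV"
      by (rule infsum_cmult_right')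
    finally show ?thesis by (simp add: w_def L_def)
  qed
  have lim_g: "(\<lambda>n. infsum (g n) UNIV) \<longlonglongrightarrow> infsum (\<lambda>k. exp (- pi * t * (of_int k)\<^sup>2) * cos (2 * pi * a * of_int k)) UNIV"
  proof -
    have c0: "central_binom (m n) 0 > 0" for n by (simp add: central_binom_def)
    have ab: "central_binom (m n) (2 * int (p n) * k) = central_binom (m n) (int (2 * p n * nat \<bar>k\<bar>))" for n and k :: int
      using central_binom_uminus[of "m n" "2 * int (p n) * k"] by (cases "k \<ge> 0") auto
    have Lk: "real (2 * p n * nat \<bar>k\<bar>) = L n * \<bar>of_int k\<bar>" for n and k :: int
      by (simp add: L_def)
    define h where "h n k = central_binom (m n) (2 * int (p n) * k) / central_binom (m n) 0" for n k
    have h_nonneg: "h n k \<ge> 0" for n k by (simp add: h_def central_binom_nonneg)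
    have h_le: "h n k \<le> exp (- ((of_int k)\<^sup>2 / (r n + \<bar>of_int k\<bar> / L n)))" for n k
    proof -
      have "h n k \<le> exp (- (L n * \<bar>of_int k\<bar>)\<^sup>2 / (real (m n) + L n * \<bar>of_int k\<bar>))"
        using central_binom_le[OF order_refl m_pos[of n], of "2 * p n * nat \<bar>k\<bar>"] c0[of n]
        unfolding h_def ab Lk by (simp add: field_simps)
      also have "real (m n) + L n * \<bar>of_int k\<bar> = (L n)\<^sup>2 * (r n + \<bar>of_int k\<bar> / L n)"
        using L[of n] by (simp add: m_eq power2_eq_square field_simps)
      also have "- (L n * \<bar>of_int k\<bar>)\<^sup>2 / ((L n)\<^sup>2 * (r n + \<bar>of_int k\<bar> / L n)) = - ((of_int k)\<^sup>2 / (r n + \<bar>of_int k\<bar> / L n))"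
        using L[of n] by (simp add: power_mult_distrib)
      finally show ?thesis .
    qed
    have h_ge: "h n k \<ge> exp (- ((of_int k)\<^sup>2 / (r n - \<bar>of_int k\<bar> / L n + (1 / L n)\<^sup>2)))" if "\<bar>of_int k\<bar> / L n \<le> r n" for n k
    proof -
      have "\<bar>of_int k\<bar> \<le> r n * L n" using that L[of n] by (simp add: field_simps)
      then have "L n * \<bar>of_int k\<bar> \<le> real (m n)"
        unfolding m_eq using L[of n] by (simp add: power2_eq_square mult.assoc mult.left_commute)
      then have le: "2 * p n * nat \<bar>k\<bar> \<le> m n" unfolding Lk[symmetric] by (simp only: of_nat_le_iff)
      have "exp (- (L n * \<bar>of_int k\<bar>)\<^sup>2 / (real (m n) - L n * \<bar>of_int k\<bar> + 1)) \<le> h n k"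
        using central_binom_ge[OF order_refl le] c0[of n]
        unfolding h_def ab Lk by (simp add: field_simps)
      also have "real (m n) - L n * \<bar>of_int k\<bar> + 1 = (L n)\<^sup>2 * (r n - \<bar>of_int k\<bar> / L n + (1 / L n)\<^sup>2)"
        using L[of n] by (simp add: m_eq power2_eq_square field_simps)
      also have "- (L n * \<bar>of_int k\<bar>)\<^sup>2 / ((L n)\<^sup>2 * (r n - \<bar>of_int k\<bar> / L n + (1 / L n)\<^sup>2)) = - ((of_int k)\<^sup>2 / (r n - \<bar>of_int k\<bar> / L n + (1 / L n)\<^sup>2))"
        using L[of n] by (simp add: power_mult_distrib)
      finally show ?thesis .
    qed
    \<comment> \<open>Inside the support K is taken to be \<open>m n\<close>, so the denominator is
      \<open>2 * m n\<close> and one Gaussian serves for all n; outside it the coefficient is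
      0.\<close>
    have h_bound: "h n k \<le> exp (- ((of_int k)\<^sup>2 / (2 * (1 / D + 1))))" for n k
    proof (cases "2 * p n * nat \<bar>k\<bar> \<le> m n")
      case True
      have "h n k \<le> exp (- (L n * \<bar>of_int k\<bar>)\<^sup>2 / (real (m n) + real (m n)))"
        using central_binom_le[OF True m_pos[of n]] c0[of n]
        unfolding h_def ab Lk by (simp add: field_simps)
      also have "- (L n * \<bar>of_int k\<bar>)\<^sup>2 / (real (m n) + real (m n)) = - ((of_int k)\<^sup>2 / (2 * r n))"
        using L[of n] by (simp add: m_eq power_mult_distrib)
      also have "exp (- ((of_int k)\<^sup>2 / (2 * r n))) \<le> exp (- ((of_int k)\<^sup>2 / (2 * (1 / D + 1))))"
      proof -
        have "(of_int k)\<^sup>2 / (2 * (1 / D + 1)) \<le> (real_of_int k)\<^sup>2 / (2 * r n)"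
          using r_le[of n] r_pos[of n] D by (intro divide_left_mono) auto
        then show ?thesis by simp
      qed
      finally show ?thesis .
    next
      case False
      then have "central_binom (m n) (int (2 * p n * nat \<bar>k\<bar>)) = 0"
        unfolding central_binom_def by (simp del: of_nat_mult)
      then show ?thesis unfolding h_def ab by simp
    qed
    show ?thesis
    proof (rule tannery_int[where N = 0 and M = "\<lambda>k. exp (0 * \<bar>of_int k\<bar> - 1 / (2 * (1 / D + 1)) * (of_int k)\<^sup>2)"])
      fix k :: int
      have e: "exp (- pi * t * (of_int k)\<^sup>2) = exp (- ((of_int k)\<^sup>2 / (1 / D)))"
        by (simp add: D_def mult_ac)
      have "(\<lambda>n. h n k) \<longlonglongrightarrow> exp (- pi * t * (of_int k)\<^sup>2)"
        unfolding e
      proof (rule tendsto_sandwich[of "\<lambda>n. exp (- ((of_int k)\<^sup>2 / (r n - \<bar>of_int k\<bar> / L n + (1 / L n)\<^sup>2)))" _ _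
            "\<lambda>n. exp (- ((of_int k)\<^sup>2 / (r n + \<bar>of_int k\<bar> / L n)))"])
        have "(\<lambda>n. exp (- ((of_int k)\<^sup>2 / (r n + \<bar>of_int k\<bar> / L n)))) \<longlonglongrightarrow> exp (- ((of_int k)\<^sup>2 / (1 / D + 0)))"
          using D by (intro tendsto_intros r_lim Li) simp
        then show "(\<lambda>n. exp (- ((of_int k)\<^sup>2 / (r n + \<bar>of_int k\<bar> / L n)))) \<longlonglongrightarrow> exp (- ((of_int k)\<^sup>2 / (1 / D)))"
          by simp
        have "(\<lambda>n. exp (- ((of_int k)\<^sup>2 / (r n - \<bar>of_int k\<bar> / L n + (1 / L n)\<^sup>2)))) \<longlonglongrightarrow> exp (- ((of_int k)\<^sup>2 / (1 / D - 0 + 0\<^sup>2)))"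
          using D by (intro tendsto_intros r_lim Li) simp
        then show "(\<lambda>n. exp (- ((of_int k)\<^sup>2 / (r n - \<bar>of_int k\<bar> / L n + (1 / L n)\<^sup>2)))) \<longlonglongrightarrow> exp (- ((of_int k)\<^sup>2 / (1 / D)))"
          by simp
        show "eventually (\<lambda>n. h n k \<le> exp (- ((of_int k)\<^sup>2 / (r n + \<bar>of_int k\<bar> / L n)))) sequentially"
          using h_le by simp
        have "eventually (\<lambda>n. \<bar>of_int k\<bar> / L n < 1 / D) sequentially"
          using order_tendstoD(2)[OF Li, of "1 / D"] D by simp
        then show "eventually (\<lambda>n. exp (- ((of_int k)\<^sup>2 / (r n - \<bar>of_int k\<bar> / L n + (1 / L n)\<^sup>2))) \<le> h n k) sequentially"
        proof eventually_elim
          case (elim n)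
          then show ?case using r_ge[of n] by (intro h_ge) linarith
        qed
      qed
      then show "(\<lambda>n. g n k) \<longlonglongrightarrow> exp (- pi * t * (of_int k)\<^sup>2) * cos (2 * pi * a * of_int k)"
        unfolding g_def h_def by (intro tendsto_mult tendsto_const)
    next
      fix n :: nat and k :: int
      have "\<bar>g n k\<bar> = h n k * \<bar>cos (2 * pi * a * of_int k)\<bar>"
        using h_nonneg[of n k] by (simp add: g_def h_def[symmetric] abs_mult)
      also have "\<dots> \<le> h n k * 1"
        using h_nonneg by (intro mult_left_mono) auto
      also have "\<dots> \<le> exp (0 * \<bar>of_int k\<bar> - 1 / (2 * (1 / D + 1)) * (of_int k)\<^sup>2)"
        using h_bound[of n k] by simp
      finally show "\<bar>g n k\<bar> \<le> exp (0 * \<bar>of_int k\<bar> - 1 / (2 * (1 / D + 1)) * (of_int k)\<^sup>2)" .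
    next
      have "1 / (2 * (1 / D + 1)) > 0" using D by (intro divide_pos_pos mult_pos_pos add_pos_pos) auto
      then show "(\<lambda>k::int. exp (0 * \<bar>of_int k\<bar> - 1 / (2 * (1 / D + 1)) * (of_int k)\<^sup>2)) summable_on UNIV"
        by (rule summable_on_int_gauss)
    qed
  qed
  \<comment> \<open>\<open>(w n)^2\<close> is the Wallis term times
    \<open>(L n)^2 / (2 * m n + 1)\<close>. The factors tend to \<open>2 / pi\<close> and
    \<open>D / 2\<close>, with product t.\<close>
  have lim_w: "w \<longlonglongrightarrow> sqrt t"
  proof -
    have "filterlim (\<lambda>n. real (m n)) at_top sequentially"
    proof (rule filterlim_at_top_mono)
      show "filterlim (\<lambda>n. 1 / D * (L n * L n)) at_top sequentially"
        using D by (intro filterlim_tendsto_pos_mult_at_top[OF tendsto_const] filterlim_at_top_mult_at_top Linf) auto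
      show "eventually (\<lambda>n. 1 / D * (L n * L n) \<le> real (m n)) sequentially"
        using m_bounds(1) by (simp add: power2_eq_square)
    qed
    then have minf: "filterlim m at_top sequentially"
      by (simp add: filterlim_sequentially_iff_filterlim_real)
    have 1: "(\<lambda>n. (2 * real (m n) + 1) * (central_binom (m n) 0 / 4 ^ m n)\<^sup>2) \<longlonglongrightarrow> 2 / pi"
      by (rule filterlim_compose[OF central_binom_wallis minf])
    have "(\<lambda>n. 1 / (2 * r n + (1 / L n)\<^sup>2)) \<longlonglongrightarrow> 1 / (2 * (1 / D) + 0\<^sup>2)"
      using D by (intro tendsto_intros r_lim Li) simp
    from tendsto_mult[OF this 1]
    have "(\<lambda>n. 1 / (2 * r n + (1 / L n)\<^sup>2) * ((2 * real (m n) + 1) * (central_binom (m n) 0 / 4 ^ m n)\<^sup>2)) \<longlonglongrightarrow> t"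
      by (simp add: D_def)
    also have "(\<lambda>n. 1 / (2 * r n + (1 / L n)\<^sup>2) * ((2 * real (m n) + 1) * (central_binom (m n) 0 / 4 ^ m n)\<^sup>2)) = (\<lambda>n. (w n)\<^sup>2)"
    proof
      fix n
      have "2 * real (m n) + 1 = (L n)\<^sup>2 * (2 * r n + (1 / L n)\<^sup>2)"
        using L[of n] by (simp add: m_eq power_divide field_simps)
      moreover have "2 * r n + (1 / L n)\<^sup>2 > 0" using r_pos[of n] by (simp add: add_pos_nonneg)
      ultimately show "1 / (2 * r n + (1 / L n)\<^sup>2) * ((2 * real (m n) + 1) * (central_binom (m n) 0 / 4 ^ m n)\<^sup>2) = (w n)\<^sup>2"
        by (simp add: w_def power_mult_distrib power_divide)
    qed
    finally have "(\<lambda>n. sqrt ((w n)\<^sup>2)) \<longlonglongrightarrow> sqrt t" by (rule tendsto_real_sqrt)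
    moreover have "w n \<ge> 0" for n using L[of n] by (simp add: w_def central_binom_nonneg)
    ultimately show ?thesis by simp
  qed
  show ?thesis
    by (rule LIMSEQ_unique[OF lim_f]) (unfold fg, rule tendsto_mult[OF lim_w lim_g])
qed

section \<open>Theta constants and their inversion\<close>

definition jacobi2 :: "real \<Rightarrow> real"
  where "jacobi2 t = theta (t / 4) {n. odd n}"

definition jacobi3 :: "real \<Rightarrow> real"
  where "jacobi3 t = theta t UNIV"

definition jacobi4 :: "real \<Rightarrow> real"
  where "jacobi4 t = theta t {n. even n} - theta t {n. odd n}"

lemma theta_even: "theta t {n. even n} = jacobi3 (4 * t)"
proof -
  have "{n. even n} = (*) 2 ` (UNIV :: int set)"
    by (auto elim!: evenE)
  then show ?thesis
    using theta_scale[of 2 t UNIV] by (simp only: jacobi3_def) (simp add: mult.commute)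
qed

lemma theta_odd: "theta t {n. odd n} = jacobi2 (4 * t)"
  by (simp add: jacobi2_def)

lemma jacobi3_inversion:
  assumes "t > 0"
  shows "jacobi3 (1 / t) = sqrt t * jacobi3 t"
  using theta_inversion_limit[OF assms, of 0]
  by (simp add: jacobi3_def theta_def)

text \<open>The classical form with half-integral indices, which are the halves of the odd numbers;
  this explains the parameter \<open>t / 4\<close> in \<open>jacobi2\<close>.\<close>

lemma jacobi2_shift: "jacobi2 t = (\<Sum>\<^sub>\<infinity>j::int. exp (- (pi * t) * (of_int j + 1 / 2)\<^sup>2))"
  unfolding jacobi2_def theta_def
proof (rule infsum_reindex_bij_witness[of _ "\<lambda>j. 2 * j + 1" "\<lambda>n. n div 2"])
  fix n :: int assume "n \<in> {n. odd n}"
  then obtain j where j: "n = 2 * j + 1" by (auto elim: oddE)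
  have "4 * (of_int j + 1 / 2)\<^sup>2 = (real_of_int n)\<^sup>2"
    by (simp add: j power2_eq_square algebra_simps)
  then show "exp (- (pi * t) * (of_int (n div 2) + 1 / 2)\<^sup>2) = exp (- pi * (t / 4) * (of_int n)\<^sup>2)"
    by (simp add: j)
qed (auto elim: oddE)

lemma jacobi4_sum:
  assumes "t > 0"
  shows "jacobi4 t = (\<Sum>\<^sub>\<infinity>k::int. (if even k then 1 else - 1) * exp (- pi * t * (of_int k)\<^sup>2))"
proof (rule infsumI[symmetric])
  let ?e = "\<lambda>k::int. exp (- pi * t * (of_int k)\<^sup>2)"
  have hs: "(?e has_sum theta t S) S" for S
    unfolding theta_def by (intro has_sum_infsum theta_summable assms)
  have "((\<lambda>k. (if even k then 1 else - 1) * ?e k) has_sum theta t {n. even n}) {n. even n}"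
    using hs by (rule has_sum_cong[THEN iffD1, rotated]) simp
  moreover have "((\<lambda>k. - ?e k) has_sum - theta t {n. odd n}) {n. odd n}"
    by (rule has_sum_uminusI[OF hs])
  then have "((\<lambda>k. (if even k then 1 else - 1) * ?e k) has_sum - theta t {n. odd n}) {n. odd n}"
    by (rule has_sum_cong[THEN iffD1, rotated]) simp
  ultimately have "((\<lambda>k. (if even k then 1 else - 1) * ?e k) has_sum (theta t {n. even n} + - theta t {n. odd n})) ({n. even n} \<union> {n. odd n})"
    by (rule has_sum_Un_disjoint) auto
  moreover have "{n::int. even n} \<union> {n. odd n} = UNIV" by auto
  ultimately show "((\<lambda>k. (if even k then 1 else - 1) * ?e k) has_sum jacobi4 t) UNIV"
    by (simp add: jacobi4_def)
qed

text \<open>A shift of the Gaussian by \<open>a = 1 / 2\<close> becomes the weight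
  \<open>cos (pi * k)\<close>, an alternating sign, on the other side.\<close>

lemma jacobi2_inversion:
  assumes "t > 0"
  shows "jacobi2 (1 / t) = sqrt t * jacobi4 t"
proof -
  have "cos (2 * pi * (1 / 2) * of_int k) = (if even k then 1 else - 1)" for k :: int
    by (auto elim!: evenE oddE simp: cos_add distrib_left cos_int_2pin mult.assoc[symmetric] mult.commute[of _ 2])
  then have "(\<Sum>\<^sub>\<infinity>k::int. exp (- pi * t * (of_int k)\<^sup>2) * cos (2 * pi * (1 / 2) * of_int k)) = jacobi4 t"
    unfolding jacobi4_sum[OF assms] by (simp only: mult.commute)
  then show ?thesis
    using theta_inversion_limit[OF assms, of "1 / 2"] by (simp add: jacobi2_shift)
qed

lemma jacobi4_inversion:
  assumes "t > 0"
  shows "jacobi4 (1 / t) = sqrt t * jacobi2 t"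
proof -
  have "sqrt t * sqrt (1 / t) = 1"
    using assms by (simp flip: real_sqrt_mult)
  then show ?thesis
    using jacobi2_inversion[of "1 / t"] assms by simp
qed

section \<open>Jacobi theta constants\<close>

lemma theta_pos:
  assumes "t > 0" "S \<noteq> {}"
  shows "theta t S > 0"
proof -
  obtain n where n: "n \<in> S" using assms by blast
  have "0 < exp (- pi * t * (of_int n)\<^sup>2)" by simp
  also have "\<dots> = theta t {n}" by (simp add: theta_def)
  also have "\<dots> \<le> theta t S"
    unfolding theta_def using n assms by (intro infsum_mono2 theta_summable) auto
  finally show ?thesis .
qed

lemma jacobi2_pos:
  assumes "t > 0"
  shows "jacobi2 t > 0"
proof -
  have "(1::int) \<in> {n. odd n}" by simp
  then show ?thesis
    unfolding jacobi2_def by (intro theta_pos) (use assms in \<open>simp, blast\<close>)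
qed

lemma jacobi3_pos: "t > 0 \<Longrightarrow> jacobi3 t > 0"
  unfolding jacobi3_def by (rule theta_pos) auto

text \<open>The alternating series does not show its sign; inversion rewrites it as a series of
  positive terms.\<close>

lemma jacobi4_pos:
  assumes "t > 0"
  shows "jacobi4 t > 0"
  using jacobi4_inversion[of "1 / t"] jacobi2_pos[of "1 / t"] assms by simp

lemma jacobi3_split: "t > 0 \<Longrightarrow> jacobi3 t = theta t {n. even n} + theta t {n. odd n}"
  unfolding jacobi3_def by (rule theta_even_odd)

text \<open>With E and O the even and odd parts of the series, \<open>jacobi3 t = E + O\<close> and
  \<open>jacobi4 t = E - O\<close>. Their squares have sum 2 (E^2 + O^2) and difference 4 E O, and
  the Gaussian substitution evaluates both.\<close>

lemma jacobi3_sq_double: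
  assumes "t > 0"
  shows "2 * (jacobi3 (2 * t))\<^sup>2 = (jacobi3 t)\<^sup>2 + (jacobi4 t)\<^sup>2"
proof -
  have "(jacobi3 t)\<^sup>2 + (jacobi4 t)\<^sup>2 = 2 * ((theta t {n. even n})\<^sup>2 + (theta t {n. odd n})\<^sup>2)"
    unfolding jacobi3_split[OF assms] jacobi4_def by (simp add: power2_eq_square algebra_simps)
  then show ?thesis
    unfolding theta_even_sq_plus_odd_sq[OF assms] jacobi3_def by simp
qed

lemma jacobi2_sq_double:
  assumes "t > 0"
  shows "2 * (jacobi2 (2 * t))\<^sup>2 = (jacobi3 t)\<^sup>2 - (jacobi4 t)\<^sup>2"
proof -
  have "(jacobi3 t)\<^sup>2 - (jacobi4 t)\<^sup>2 = 2 * (2 * (theta t {n. even n} * theta t {n. odd n}))"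
    unfolding jacobi3_split[OF assms] jacobi4_def by (simp add: power2_eq_square algebra_simps)
  then show ?thesis
    unfolding theta_even_times_odd[OF assms] by (simp add: jacobi2_def)
qed

lemma jacobi2_sq:
  assumes "t > 0"
  shows "(jacobi2 t)\<^sup>2 = 2 * jacobi2 (2 * t) * jacobi3 (2 * t)"
  using theta_even_times_odd[of "t / 2"] assms
  by (simp add: theta_even theta_odd[of "t / 2"]) (simp add: jacobi2_def mult_ac)

text \<open>The difference of fourth powers factors into the two doubling formulas, and by
  \<open>jacobi2_sq\<close> their product is the fourth power of \<open>jacobi2 t\<close>.\<close>

lemma jacobi_quartic:
  assumes "t > 0"
  shows "(jacobi3 t) ^ 4 = (jacobi2 t) ^ 4 + (jacobi4 t) ^ 4"
proof -
  have "(jacobi3 t) ^ 4 - (jacobi4 t) ^ 4 = ((jacobi3 t)\<^sup>2 - (jacobi4 t)\<^sup>2) * ((jacobi3 t)\<^sup>2 + (jacobi4 t)\<^sup>2)"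
    by (simp add: power4_eq_xxxx power2_eq_square algebra_simps)
  also have "\<dots> = (2 * jacobi2 (2 * t) * jacobi3 (2 * t))\<^sup>2"
    unfolding jacobi2_sq_double[OF assms, symmetric] jacobi3_sq_double[OF assms, symmetric]
    by (simp add: power_mult_distrib)
  also have "\<dots> = (jacobi2 t) ^ 4"
    unfolding jacobi2_sq[OF assms, symmetric] by simp
  finally show ?thesis by simp
qed

text \<open>Legendre's cubic modular equation in theta constants. The two mixed parity products
  together are half the difference of the \<open>jacobi3\<close> and \<open>jacobi4\<close>
  products.\<close>

lemma jacobi_degree_3:
  assumes "t > 0"
  shows "jacobi3 t * jacobi3 (3 * t) = jacobi4 t * jacobi4 (3 * t) + jacobi2 t * jacobi2 (3 * t)"
  using theta_degree_3[OF assms] assms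
  unfolding jacobi3_split[OF assms] jacobi3_split[OF mult_pos_pos, OF zero_less_numeral assms] jacobi4_def jacobi2_def
  by (simp add: algebra_simps)

text \<open>The element of norm 2 behind \<open>theta_degree_7\<close> changes the parameter by a
  factor 2, so the points 2 t and 14 t appear beside t and 7 t.\<close>

lemma jacobi_degree_7:
  assumes "t > 0"
  shows "2 * (jacobi3 (2 * t) * jacobi3 (14 * t) + jacobi2 (2 * t) * jacobi2 (14 * t))
    = jacobi3 t * jacobi3 (7 * t) + jacobi4 t * jacobi4 (7 * t) + jacobi2 t * jacobi2 (7 * t)"
proof -
  have "4 * (t / 2) = 2 * t" "4 * (7 * t / 2) = 14 * t" by simp_all
  then have "jacobi3 (2 * t) * jacobi3 (14 * t) + jacobi2 (2 * t) * jacobi2 (14 * t) =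
     theta t {n. even n} * theta (7 * t) {n. even n} + theta t {n. odd n} * theta (7 * t) {n. odd n}
      + jacobi2 t * jacobi2 (7 * t) / 2"
    using theta_degree_7[OF assms] unfolding theta_even[of "t / 2"] theta_even[of "7 * t / 2"]
      theta_odd[of "t / 2"] theta_odd[of "7 * t / 2"] theta_odd[of "t / 4"] theta_odd[of "7 * t / 4"] by simp
  then show ?thesis
    unfolding jacobi3_split[OF assms] jacobi3_split[OF mult_pos_pos, OF zero_less_numeral assms] jacobi4_def
    by (simp add: algebra_simps)
qed

text \<open>The u of the overview. In terms of the elliptic modulus k and its complement k', its
  square is k / k'.\<close>

definition jacobi_ratio :: "real \<Rightarrow> real"
  where "jacobi_ratio t = jacobi2 t / jacobi4 t"

lemma jacobi_ratio_pos: "t > 0 \<Longrightarrow> jacobi_ratio t > 0"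
  by (simp add: jacobi_ratio_def jacobi2_pos jacobi4_pos)

lemma jacobi_ratio_inversion: "t > 0 \<Longrightarrow> jacobi_ratio (1 / t) = 1 / jacobi_ratio t"
  by (simp add: jacobi_ratio_def jacobi2_inversion jacobi4_inversion)

text \<open>Dividing the cubic equation by its \<open>jacobi4\<close> product makes
  \<open>1 + u * v\<close> a quotient of theta constants; the quartic identity does the same for
  \<open>1 + u^4\<close>, and \<open>jacobi3\<close> drops out.\<close>

lemma jacobi_ratio_degree_3:
  assumes "t > 0"
  shows "(1 + jacobi_ratio t ^ 4) * (1 + jacobi_ratio (3 * t) ^ 4) = (1 + jacobi_ratio t * jacobi_ratio (3 * t)) ^ 4"
proof -
  have 1: "1 + jacobi_ratio s ^ 4 = (jacobi3 s / jacobi4 s) ^ 4" if "s > 0" for s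
    using jacobi4_pos[OF that] jacobi_quartic[OF that]
    by (simp add: jacobi_ratio_def power_divide field_simps)
  have "1 + jacobi_ratio t * jacobi_ratio (3 * t) = (jacobi3 t / jacobi4 t) * (jacobi3 (3 * t) / jacobi4 (3 * t))"
    using jacobi4_pos[of t] jacobi4_pos[of "3 * t"] assms jacobi_degree_3[OF assms]
    by (simp add: jacobi_ratio_def field_simps)
  then show ?thesis
    using assms 1[of t] 1[of "3 * t"] by (simp add: power_mult_distrib power_divide)
qed

text \<open>By k^2 + k'^2 = 1 the left side is 1 / (k k'), a quantity fixed by inversion.\<close>

lemma jacobi_ratio_sq_plus_inverse:
  assumes "t > 0"
  shows "(jacobi_ratio t)\<^sup>2 + 1 / (jacobi_ratio t)\<^sup>2 = ((jacobi3 t)\<^sup>2 / (jacobi2 t * jacobi4 t))\<^sup>2"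
proof -
  have "(jacobi_ratio t)\<^sup>2 + 1 / (jacobi_ratio t)\<^sup>2 = (jacobi2 t ^ 4 + jacobi4 t ^ 4) / (jacobi2 t * jacobi4 t)\<^sup>2"
    using jacobi4_pos[OF assms] jacobi2_pos[OF assms]
    by (simp add: jacobi_ratio_def field_simps power2_eq_square power4_eq_xxxx)
  then show ?thesis
    unfolding jacobi_quartic[OF assms, symmetric] by (simp add: power_divide)
qed

text \<open>With \<open>s = sqrt 7\<close>, inversion leaves theta constants at
  \<open>s / 2\<close>, s and \<open>2 * s\<close>. The doubling formulas express the squares of the
  products X and Y by values at s, and the quartic identity does so for \<open>X * Y\<close>; hence
  \<open>(X + Y)^2\<close> is a polynomial in A, B, C.\<close>

lemma jacobi_ratio_sqrt_7: "(jacobi_ratio (sqrt 7))\<^sup>2 + 1 / (jacobi_ratio (sqrt 7))\<^sup>2 = 16"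
proof -
  define s where "s = sqrt (7::real)"
  have s: "s > 0" "s\<^sup>2 = 7" by (simp_all add: s_def)
  define A B C where "A = jacobi2 s" and "B = jacobi4 s" and "C = jacobi3 s"
  have pos: "A > 0" "B > 0" "C > 0" using s by (simp_all add: A_def B_def C_def jacobi2_pos jacobi3_pos jacobi4_pos)
  have q: "C ^ 4 = A ^ 4 + B ^ 4" unfolding A_def B_def C_def by (rule jacobi_quartic) fact
  have 7: "7 * (1 / s) = s" "2 * (1 / s) = 1 / (s / 2)" "14 * (1 / s) = 2 * s"
    using s by (simp_all add: field_simps power2_eq_square)
  define X Y where "X = jacobi3 (s / 2) * jacobi3 (2 * s)" and "Y = jacobi4 (s / 2) * jacobi2 (2 * s)"
  have XY: "X > 0" "Y > 0" using s by (simp_all add: X_def Y_def jacobi2_pos jacobi3_pos jacobi4_pos)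
  have "2 * (sqrt (s / 2) * X + sqrt (s / 2) * Y) = sqrt s * (C\<^sup>2 + 2 * (A * B))"
  proof -
    have "jacobi3 (1 / (s / 2)) = sqrt (s / 2) * jacobi3 (s / 2)" "jacobi2 (1 / (s / 2)) = sqrt (s / 2) * jacobi4 (s / 2)"
      using s by (simp_all only: jacobi2_inversion jacobi3_inversion half_gt_zero)
    moreover have "jacobi3 (1 / s) = sqrt s * C" "jacobi2 (1 / s) = sqrt s * B" "jacobi4 (1 / s) = sqrt s * A"
      using s by (simp_all add: jacobi2_inversion jacobi3_inversion jacobi4_inversion A_def B_def C_def)
    ultimately have "2 * (sqrt (s / 2) * jacobi3 (s / 2) * jacobi3 (2 * s) + sqrt (s / 2) * jacobi4 (s / 2) * jacobi2 (2 * s))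
        = sqrt s * C * C + sqrt s * A * B + sqrt s * B * A"
      using jacobi_degree_7[of "1 / s"] s unfolding 7 by (simp only: A_def B_def C_def) simp
    then show ?thesis
      by (simp add: X_def Y_def power2_eq_square algebra_simps)
  qed
  then have "sqrt s * (2 * (X + Y) / sqrt 2) = sqrt s * (C\<^sup>2 + 2 * (A * B))"
    by (simp add: real_sqrt_divide field_simps)
  then have XY_AB: "2 * (X + Y) / sqrt 2 = C\<^sup>2 + 2 * (A * B)"
    unfolding mult_cancel_left using s by simp
  have sq: "2 * (X + Y)\<^sup>2 = (C\<^sup>2 + 2 * (A * B))\<^sup>2"
  proof -
    have "(2 * (X + Y) / sqrt 2)\<^sup>2 = 2 * (X + Y)\<^sup>2" by (simp add: power_divide power_mult_distrib del: distrib_left_numeral)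
    then show ?thesis unfolding XY_AB by simp
  qed
  have h: "2 * (s / 2) = s" by simp
  have X2: "(jacobi3 (s / 2))\<^sup>2 = C\<^sup>2 + A\<^sup>2" "(jacobi4 (s / 2))\<^sup>2 = C\<^sup>2 - A\<^sup>2"
    using jacobi3_sq_double[of "s / 2"] jacobi2_sq_double[of "s / 2"] s unfolding h by (simp_all add: A_def C_def)
  have X3: "2 * (jacobi3 (2 * s))\<^sup>2 = C\<^sup>2 + B\<^sup>2" "2 * (jacobi2 (2 * s))\<^sup>2 = C\<^sup>2 - B\<^sup>2"
    using jacobi3_sq_double[of s] jacobi2_sq_double[of s] s by (simp_all add: B_def C_def)
  have XX: "2 * X\<^sup>2 = (C\<^sup>2 + A\<^sup>2) * (C\<^sup>2 + B\<^sup>2)" "2 * Y\<^sup>2 = (C\<^sup>2 - A\<^sup>2) * (C\<^sup>2 - B\<^sup>2)"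
    unfolding X_def Y_def power_mult_distrib X2[symmetric] X3[symmetric] by simp_all
  \<comment> \<open>By the quartic identity the two differences of fourth powers are B^4 and A^4, so
    the root can be extracted.\<close>
  have "(2 * (X * Y))\<^sup>2 = (2 * X\<^sup>2) * (2 * Y\<^sup>2)" by (simp add: power_mult_distrib)
  also have "\<dots> = (C ^ 4 - A ^ 4) * (C ^ 4 - B ^ 4)"
    unfolding XX by (simp add: power4_eq_xxxx power2_eq_square algebra_simps)
  also have "\<dots> = (A\<^sup>2 * B\<^sup>2)\<^sup>2" unfolding q by (simp add: power_mult_distrib)
  finally have XY2: "2 * (X * Y) = A\<^sup>2 * B\<^sup>2"
    using XY by (subst (asm) power2_eq_iff_nonneg) auto
  have "2 * (X + Y)\<^sup>2 = 2 * X\<^sup>2 + 2 * Y\<^sup>2 + 2 * (2 * (X * Y))"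
    by (simp add: power2_sum algebra_simps)
  also have "\<dots> = 2 * C ^ 4 + 4 * (A\<^sup>2 * B\<^sup>2)"
    unfolding XX XY2 by (simp add: power4_eq_xxxx power2_eq_square algebra_simps)
  finally have "(C\<^sup>2 + 2 * (A * B))\<^sup>2 = 2 * C ^ 4 + 4 * (A\<^sup>2 * B\<^sup>2)"
    using sq by simp
  \<comment> \<open>The terms in \<open>A^2 * B^2\<close> cancel, which is why the value is
    rational.\<close>
  then have "C\<^sup>2 * (4 * (A * B)) = C\<^sup>2 * C\<^sup>2"
    by (simp add: power4_eq_xxxx power2_eq_square algebra_simps)
  then have "4 * (A * B) = C\<^sup>2" unfolding mult_cancel_left using pos by simp
  then have "C\<^sup>2 / (A * B) = 4" using pos by (simp add: field_simps)
  then show ?thesis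
    unfolding s_def[symmetric] using jacobi_ratio_sq_plus_inverse[OF s(1)] by (simp add: A_def B_def C_def)
qed

section \<open>The Jacobi triple product\<close>

lemma qpochhammer_convergent:
  fixes a x :: real
  assumes "0 < x" "x < 1"
  shows "convergent_prod (\<lambda>k. 1 - a * x ^ k)"
proof -
  have "summable (\<lambda>k. \<bar>a\<bar> * x ^ k)"
    using assms by (intro summable_mult summable_geometric) auto
  then have "summable (\<lambda>k. norm ((1 - a * x ^ k) - 1))"
    using assms by (simp add: abs_mult)
  then have "abs_convergent_prod (\<lambda>k. 1 - a * x ^ k)"
    by (simp only: abs_convergent_prod_conv_summable)
  then show ?thesis by (rule abs_convergent_prod_imp_convergent_prod)
qed

lemma qpochhammer_lim:
  fixes a x :: real
  assumes "0 < x" "x < 1"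
  shows "(\<lambda>n. \<Prod>k<n. 1 - a * x ^ k) \<longlonglongrightarrow> qpochhammer_inf a x"
proof -
  have "(\<lambda>n. \<Prod>k\<le>n. 1 - a * x ^ k) \<longlonglongrightarrow> qpochhammer_inf a x"
    unfolding qpochhammer_inf_def by (rule convergent_prod_LIMSEQ[OF qpochhammer_convergent[OF assms]])
  then show ?thesis
    by (subst (asm) lessThan_Suc_atMost[symmetric]) (rule LIMSEQ_imp_Suc)
qed

lemma qpochhammer_pos:
  fixes a x :: real
  assumes "0 < x" "x < 1" "a < 1"
  shows "qpochhammer_inf a x > 0"
  unfolding qpochhammer_inf_def
proof (rule less_0_prodinf[OF qpochhammer_convergent[OF assms(1,2)]])
  fix k
  have "x ^ k \<le> 1" "x ^ k > 0" using assms by (auto intro: power_le_one)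
  then have "a * x ^ k < 1"
    using assms by (smt (verit) mult_le_cancel_right1 mult_nonpos_nonneg zero_less_mult_iff)
  then show "0 < 1 - a * x ^ k" by simp
qed

text \<open>The exponents are sorted by their residue mod m. The case m = 5 splits products in base
  q^2 into products in base q^10.\<close>

lemma qpochhammer_regroup:
  fixes a x :: real
  assumes "0 < x" "x < 1" "m > 0"
  shows "qpochhammer_inf a x = (\<Prod>r<m. qpochhammer_inf (a * x ^ r) (x ^ m))"
proof (rule LIMSEQ_unique)
  have xm: "0 < x ^ m" "x ^ m < 1" using assms by (auto simp: power_less_one_iff)
  have "filterlim (\<lambda>n. n * m) at_top sequentially"
    using assms(3) by (intro filterlim_subseq) (auto simp: strict_mono_def)
  then show "(\<lambda>n. \<Prod>k<n * m. 1 - a * x ^ k) \<longlonglongrightarrow> qpochhammer_inf a x"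
    by (rule filterlim_compose[OF qpochhammer_lim[OF assms(1,2)]])
  have "(\<Prod>k<n * m. 1 - a * x ^ k) = (\<Prod>r<m. \<Prod>i<n. 1 - a * x ^ r * (x ^ m) ^ i)" for n
  proof -
    have "(\<Prod>k<n * m. 1 - a * x ^ k) = (\<Prod>i<n. \<Prod>k\<in>{i * m..<i * m + m}. 1 - a * x ^ k)"
      by (rule prod.nat_group[symmetric])
    also have "\<dots> = (\<Prod>i<n. \<Prod>r<m. 1 - a * x ^ r * (x ^ m) ^ i)"
    proof (rule prod.cong[OF refl])
      fix i
      show "(\<Prod>k\<in>{i * m..<i * m + m}. 1 - a * x ^ k) = (\<Prod>r<m. 1 - a * x ^ r * (x ^ m) ^ i)"
        by (rule prod.reindex_bij_witness[of _ "\<lambda>r. i * m + r" "\<lambda>k. k - i * m"])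
           (auto simp flip: power_mult power_add simp: mult_ac)
    qed
    also have "\<dots> = (\<Prod>r<m. \<Prod>i<n. 1 - a * x ^ r * (x ^ m) ^ i)" by (rule prod.swap)
    finally show ?thesis .
  qed
  then show "(\<lambda>n. \<Prod>k<n * m. 1 - a * x ^ k) \<longlonglongrightarrow> (\<Prod>r<m. qpochhammer_inf (a * x ^ r) (x ^ m))"
    by (simp only:) (intro tendsto_prod qpochhammer_lim xm)
qed

lemma qpochhammer_Suc:
  fixes a x :: real
  assumes "0 < x" "x < 1"
  shows "qpochhammer_inf a x = (1 - a) * qpochhammer_inf (a * x) x"
proof (rule LIMSEQ_unique)
  show "(\<lambda>n. \<Prod>k<Suc n. 1 - a * x ^ k) \<longlonglongrightarrow> qpochhammer_inf a x"
    by (rule LIMSEQ_Suc[OF qpochhammer_lim[OF assms]])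
  have "(\<Prod>k<Suc n. 1 - a * x ^ k) = (1 - a) * (\<Prod>k<n. 1 - a * x * x ^ k)" for n
    by (simp only: prod.lessThan_Suc_shift) (simp add: mult.assoc)
  then show "(\<lambda>n. \<Prod>k<Suc n. 1 - a * x ^ k) \<longlonglongrightarrow> (1 - a) * qpochhammer_inf (a * x) x"
    by (simp only:) (intro tendsto_mult tendsto_const qpochhammer_lim assms)
qed

lemma qpochhammer_mult_uminus:
  fixes a x :: real
  assumes "0 < x" "x < 1"
  shows "qpochhammer_inf a x * qpochhammer_inf (- a) x = qpochhammer_inf (a\<^sup>2) (x\<^sup>2)"
proof (rule LIMSEQ_unique)
  show "(\<lambda>n. (\<Prod>k<n. 1 - a * x ^ k) * (\<Prod>k<n. 1 - (- a) * x ^ k)) \<longlonglongrightarrow> qpochhammer_inf a x * qpochhammer_inf (- a) x"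
    by (intro tendsto_mult qpochhammer_lim assms)
  have "(\<Prod>k<n. 1 - a * x ^ k) * (\<Prod>k<n. 1 - (- a) * x ^ k) = (\<Prod>k<n. 1 - a\<^sup>2 * (x\<^sup>2) ^ k)" for n
    unfolding prod.distrib[symmetric]
    by (rule prod.cong) (simp_all add: power2_eq_square power_mult_distrib algebra_simps)
  moreover have "0 < x\<^sup>2" "x\<^sup>2 < 1" using assms by (auto simp: power_less_one_iff)
  ultimately show "(\<lambda>n. (\<Prod>k<n. 1 - a * x ^ k) * (\<Prod>k<n. 1 - (- a) * x ^ k)) \<longlonglongrightarrow> qpochhammer_inf (a\<^sup>2) (x\<^sup>2)"
    by (simp only:) (rule qpochhammer_lim)
qed

text \<open>Euler's theorem on partitions into distinct and into odd parts for
  \<open>y = q^2\<close>, with the product over odd parts factored further into those at q and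
  \<open>- q\<close>.\<close>

lemma qpochhammer_euler:
  fixes q :: real
  assumes "0 < q" "q < 1"
  shows "qpochhammer_inf (- (q\<^sup>2)) (q\<^sup>2) * qpochhammer_inf q (q\<^sup>2) * qpochhammer_inf (- q) (q\<^sup>2) = 1"
proof -
  define y where "y = q\<^sup>2"
  have y: "0 < y" "y < 1" using assms by (auto simp: y_def power_less_one_iff)
  then have y2: "0 < y\<^sup>2" "y\<^sup>2 < 1" by (auto simp: power_less_one_iff)
  have "qpochhammer_inf y y * qpochhammer_inf (- y) y = qpochhammer_inf (y\<^sup>2) (y\<^sup>2)"
    by (rule qpochhammer_mult_uminus[OF y])
  moreover have "qpochhammer_inf y y = qpochhammer_inf y (y\<^sup>2) * qpochhammer_inf (y\<^sup>2) (y\<^sup>2)"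
    using qpochhammer_regroup[OF y, of 2 y] by (simp add: lessThan_Suc numeral_2_eq_2)
  moreover have "qpochhammer_inf q y * qpochhammer_inf (- q) y = qpochhammer_inf y (y\<^sup>2)"
    using qpochhammer_mult_uminus[OF y, of q] by (simp add: y_def)
  moreover have "qpochhammer_inf (y\<^sup>2) (y\<^sup>2) > 0"
    using y2 by (intro qpochhammer_pos) auto
  ultimately have "qpochhammer_inf (- y) y * (qpochhammer_inf q y * qpochhammer_inf (- q) y) = 1"
    by (simp add: mult_ac)
  then show ?thesis unfolding y_def[symmetric] by (simp only: mult.assoc)
qed

section \<open>Gaussian binomial coefficients and the finite triple product\<close>

definition qfact :: "real \<Rightarrow> nat \<Rightarrow> real"
  where "qfact y n = (\<Prod>k<n. 1 - y * y ^ k)"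

text \<open>The Gaussian binomial coefficient; its value 0 beyond n drops the surplus top term in
  the induction for the q-binomial theorem.\<close>

definition qbinom :: "real \<Rightarrow> nat \<Rightarrow> nat \<Rightarrow> real"
  where "qbinom y n j = (if j \<le> n then qfact y n / (qfact y j * qfact y (n - j)) else 0)"

lemma qfact_0 [simp]: "qfact y 0 = 1"
  by (simp add: qfact_def)

lemma qfact_Suc: "qfact y (Suc n) = qfact y n * (1 - y ^ Suc n)"
  by (simp add: qfact_def)

lemma qfact_pos:
  assumes "0 < y" "y < 1"
  shows "qfact y n > 0"
  unfolding qfact_def
proof (rule prod_pos)
  fix k
  have "y ^ Suc k < 1" using assms by (intro power_Suc_less_one) auto
  then show "0 < 1 - y * y ^ k" by simp
qed

lemma qbinom_Suc:
  assumes "0 < y" "y < 1" "j \<le> n"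
  shows "qbinom y (Suc n) (Suc j) = qbinom y n (Suc j) + y ^ (n - j) * qbinom y n j"
proof (cases "j = n")
  case True
  have "qfact y n \<noteq> 0" "qfact y (Suc n) \<noteq> 0"
    using qfact_pos[OF assms(1,2)] by (simp_all add: less_imp_neq[symmetric])
  then show ?thesis using True by (simp add: qbinom_def)
next
  case False
  then obtain d where d: "n = Suc (j + d)" using assms(3) by (metis add_Suc_right less_imp_Suc_add nat_less_le)
  have pos: "qfact y j > 0" "qfact y d > 0" "qfact y n > 0" by (rule qfact_pos[OF assms(1,2)])+
  have lt: "1 - y ^ Suc j > 0" "1 - y ^ Suc d > 0"
    using power_Suc_less_one[of y] assms by auto
  have s: "Suc n - Suc j = Suc d" "n - Suc j = d" "n - j = Suc d" using d by auto
  \<comment> \<open>Pascal's rule is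
    \<open>1 - y^(n+1) = (1 - y^(d+1)) + y^(d+1) * (1 - y^(j+1))\<close>, divided by the two factors
    on the right.\<close>
  have "(B + C * A) / (A * B) = 1 / A + C * (1 / B)" if "A > 0" "B > 0" for A B C :: real
    using that by (simp add: field_simps)
  from this[OF lt, of "y ^ Suc d"]
  have key: "(1 - y ^ Suc n) / ((1 - y ^ Suc j) * (1 - y ^ Suc d)) = 1 / (1 - y ^ Suc j) + y ^ Suc d * (1 / (1 - y ^ Suc d))"
    by (simp add: d power_add algebra_simps)
  have "qbinom y (Suc n) (Suc j) = qfact y n / (qfact y j * qfact y d) * ((1 - y ^ Suc n) / ((1 - y ^ Suc j) * (1 - y ^ Suc d)))"
    using d unfolding qbinom_def s by (simp add: qfact_Suc mult_ac)
  moreover have "qbinom y n (Suc j) = qfact y n / (qfact y j * qfact y d) * (1 / (1 - y ^ Suc j))"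
    using d unfolding qbinom_def s by (simp add: qfact_Suc mult_ac)
  moreover have "qbinom y n j = qfact y n / (qfact y j * qfact y d) * (1 / (1 - y ^ Suc d))"
    using d unfolding qbinom_def s by (simp add: qfact_Suc mult_ac)
  ultimately show ?thesis
    unfolding s key by (simp only: distrib_left mult_ac)
qed

lemma qbinomial_theorem:
  assumes "0 < y" "y < 1"
  shows "(\<Prod>k<n. 1 + x * y ^ k) = (\<Sum>j\<le>n. y ^ (j choose 2) * qbinom y n j * x ^ j)"
proof (induction n)
  case 0
  show ?case by (simp add: qbinom_def binomial_eq_0)
next
  case (Suc n)
  have q0: "qbinom y k 0 = 1" for k
    using qfact_pos[OF assms, of k] by (simp add: qbinom_def less_imp_neq[symmetric])
  have c: "y ^ (Suc j choose 2) * y ^ (n - j) = y ^ (j choose 2) * y ^ n" if "j \<le> n" for j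
  proof -
    have "Suc j choose 2 = (j choose 2) + j" by (simp add: numeral_2_eq_2)
    then show ?thesis using that by (simp flip: power_add)
  qed
  have "(\<Sum>j\<le>Suc n. y ^ (j choose 2) * qbinom y (Suc n) j * x ^ j)
     = 1 + (\<Sum>j\<le>n. y ^ (Suc j choose 2) * (qbinom y n (Suc j) + y ^ (n - j) * qbinom y n j) * x ^ Suc j)"
    unfolding sum.atMost_Suc_shift
    by (intro arg_cong2[of _ _ _ _ "(+)"] sum.cong refl) (simp_all add: q0 binomial_eq_0 qbinom_Suc[OF assms] del: power_Suc binomial_Suc_Suc)
  also have "\<dots> = 1 + (\<Sum>j\<le>n. y ^ (Suc j choose 2) * qbinom y n (Suc j) * x ^ Suc j)
      + (\<Sum>j\<le>n. y ^ (j choose 2) * qbinom y n j * x ^ j) * (x * y ^ n)"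
  proof -
    have "y ^ (Suc j choose 2) * (qbinom y n (Suc j) + y ^ (n - j) * qbinom y n j) * x ^ Suc j =
      y ^ (Suc j choose 2) * qbinom y n (Suc j) * x ^ Suc j + y ^ (j choose 2) * qbinom y n j * x ^ j * (x * y ^ n)"
      if "j \<le> n" for j
      using arg_cong[OF c[OF that], of "\<lambda>z. z * (qbinom y n j * x ^ Suc j)"] by (simp add: algebra_simps)
    then have "(\<Sum>j\<le>n. y ^ (Suc j choose 2) * (qbinom y n (Suc j) + y ^ (n - j) * qbinom y n j) * x ^ Suc j) =
      (\<Sum>j\<le>n. y ^ (Suc j choose 2) * qbinom y n (Suc j) * x ^ Suc j + y ^ (j choose 2) * qbinom y n j * x ^ j * (x * y ^ n))"
      by (intro sum.cong) auto
    then show ?thesis by (simp only: sum.distrib sum_distrib_right add.assoc)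
  qed
  also have "1 + (\<Sum>j\<le>n. y ^ (Suc j choose 2) * qbinom y n (Suc j) * x ^ Suc j) = (\<Sum>j\<le>Suc n. y ^ (j choose 2) * qbinom y n j * x ^ j)"
    unfolding sum.atMost_Suc_shift[of _ n] by (simp add: q0 binomial_eq_0)
  also have "\<dots> = (\<Sum>j\<le>n. y ^ (j choose 2) * qbinom y n j * x ^ j)"
    by (simp add: qbinom_def)
  finally show ?case
    using Suc by (simp add: algebra_simps)
qed

text \<open>The q-binomial theorem with \<open>2 * n\<close> factors in base q^2, at an x that
  centres the exponents. The upper half of the factors is the first product; each lower factor is
  inverted by extracting a monomial, and these monomials multiply to
  \<open>z^n * q powi (- n^2)\<close>.\<close>

lemma jacobi_triple_finite:
  fixes q z :: real
  assumes q: "0 < q" "q < 1" and z: "z \<noteq> 0"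
  shows "(\<Prod>k<n. 1 + z * q * (q\<^sup>2) ^ k) * (\<Prod>k<n. 1 + q / z * (q\<^sup>2) ^ k)
    = (\<Sum>j = - int n..int n. qbinom (q\<^sup>2) (2 * n) (nat (int n + j)) * (z powi j * q powi (j\<^sup>2)))"
proof -
  define x where "x = z * q powi (1 - 2 * int n)"
  have y: "0 < q\<^sup>2" "q\<^sup>2 < 1" using q by (auto simp: power_less_one_iff)
  have q0: "q \<noteq> 0" using q by simp
  have powi_add: "q powi (a + b) = q powi a * q powi b" for a b
    by (rule power_int_add) (simp add: q0)
  have "(\<Prod>k<2 * n. 1 + x * (q\<^sup>2) ^ k) = (\<Prod>k<n. 1 + x * (q\<^sup>2) ^ k) * (\<Prod>k\<in>{n..<2 * n}. 1 + x * (q\<^sup>2) ^ k)"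
    using prod.atLeastLessThan_concat[of 0 n "2 * n" "\<lambda>k. 1 + x * (q\<^sup>2) ^ k"] by (simp add: atLeast0LessThan)
  also have "(\<Prod>k\<in>{n..<2 * n}. 1 + x * (q\<^sup>2) ^ k) = (\<Prod>k<n. 1 + z * q * (q\<^sup>2) ^ k)"
  proof (rule prod.reindex_bij_witness[of _ "\<lambda>k. n + k" "\<lambda>k. k - n"])
    fix k assume k: "k \<in> {n..<2 * n}"
    have "q powi (1 - 2 * int n) * q powi (2 * int k) = q powi (1 - 2 * int n + 2 * int k)"
      by (rule powi_add[symmetric])
    also have "1 - 2 * int n + 2 * int k = 1 + 2 * int (k - n)"
      using k by (simp add: of_nat_diff)
    also have "q powi (1 + 2 * int (k - n)) = q * (q\<^sup>2) ^ (k - n)"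
      using q0 by (simp add: power_int_add power_int_mult)
    finally show "1 + z * q * (q\<^sup>2) ^ (k - n) = 1 + x * (q\<^sup>2) ^ k"
      by (simp add: x_def power_int_mult mult.assoc)
  qed auto
  also have "(\<Prod>k<n. 1 + x * (q\<^sup>2) ^ k) = (\<Prod>k<n. z * q powi (- 1 - 2 * int k) * (1 + q / z * (q\<^sup>2) ^ k))"
  proof (rule prod.reindex_bij_witness[of _ "\<lambda>k. n - 1 - k" "\<lambda>k. n - 1 - k"])
    fix k assume k: "k \<in> {..<n}"
    define i where "i = n - 1 - k"
    have i: "int i = int n - 1 - int k" using k by (simp add: i_def)
    have "x * (q\<^sup>2) ^ k = z * (q powi (1 - 2 * int n) * q powi (2 * int k))"
      by (simp add: x_def power_int_mult)
    also have "q powi (1 - 2 * int n) * q powi (2 * int k) = q powi (- 1 - 2 * int i)"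
      unfolding i using q0 by (simp flip: power_int_add add: algebra_simps)
    finally have e: "x * (q\<^sup>2) ^ k = z * q powi (- 1 - 2 * int i)" .
    have "q powi (- 1 - 2 * int i) * (q * (q\<^sup>2) ^ i) = q powi (- 1 - 2 * int i) * q powi (1 + 2 * int i)"
      using q0 by (simp add: power_int_add power_int_mult)
    also have "\<dots> = 1" using q0 by (simp flip: power_int_add)
    finally have "z * q powi (- 1 - 2 * int i) * (1 + q / z * (q\<^sup>2) ^ i) = z * q powi (- 1 - 2 * int i) + 1"
      using z by (simp add: field_simps)
    then show "z * q powi (- 1 - 2 * int (n - 1 - k)) * (1 + q / z * (q\<^sup>2) ^ (n - 1 - k)) = 1 + x * (q\<^sup>2) ^ k"
      unfolding i_def[symmetric] e by simp
  qed auto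
  also have "\<dots> = (\<Prod>k<n. z * q powi (- 1 - 2 * int k)) * (\<Prod>k<n. 1 + q / z * (q\<^sup>2) ^ k)"
    by (rule prod.distrib)
  also have "(\<Prod>k<n. z * q powi (- 1 - 2 * int k)) = z ^ n * q powi (- (int n)\<^sup>2)"
  proof (induction n)
    case (Suc n)
    have "- (int (Suc n))\<^sup>2 = - (int n)\<^sup>2 + (- 1 - 2 * int n)" by (simp add: power2_eq_square algebra_simps)
    then have "q powi (- (int (Suc n))\<^sup>2) = q powi (- (int n)\<^sup>2) * q powi (- 1 - 2 * int n)"
      by (simp only: powi_add)
    then show ?case
      unfolding prod.lessThan_Suc Suc power_Suc by (simp only: mult_ac)
  qed simp
  finally have P: "(\<Prod>k<2 * n. 1 + x * (q\<^sup>2) ^ k) = z ^ n * q powi (- (int n)\<^sup>2) *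
      ((\<Prod>k<n. 1 + z * q * (q\<^sup>2) ^ k) * (\<Prod>k<n. 1 + q / z * (q\<^sup>2) ^ k))" by (simp add: mult_ac)
  have "(\<Prod>k<2 * n. 1 + x * (q\<^sup>2) ^ k) = (\<Sum>r\<le>2 * n. (q\<^sup>2) ^ (r choose 2) * qbinom (q\<^sup>2) (2 * n) r * x ^ r)"
    by (rule qbinomial_theorem[OF y])
  also have "\<dots> = (\<Sum>j = - int n..int n. z ^ n * q powi (- (int n)\<^sup>2) *
      (qbinom (q\<^sup>2) (2 * n) (nat (int n + j)) * (z powi j * q powi (j\<^sup>2))))"
  proof (rule sum.reindex_bij_witness[of _ "\<lambda>j. nat (int n + j)" "\<lambda>r. int r - int n"])
    fix r assume r: "r \<in> {..2 * n}"
    define j where "j = int r - int n"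
    have "z powi int n * z powi j = z powi (int n + j)"
      by (rule power_int_add[symmetric]) (simp add: z)
    also have "int n + j = int r" by (simp add: j_def)
    finally have zr: "z ^ n * z powi j = z ^ r" by simp
    have "2 * int (r choose 2) = int r * int r - int r"
    proof -
      have "even (r * (r - 1))" by (cases r) auto
      then have "r * (r - 1) = 2 * (r choose 2)" unfolding choose_two by (rule dvd_mult_div_cancel[symmetric])
      then have "int (r * (r - 1)) = 2 * int (r choose 2)" by simp
      then show ?thesis by (cases r) (auto simp: algebra_simps)
    qed
    \<comment> \<open>The exponent of q completes to a square:
      \<open>r * (r - 1) + (1 - 2 * n) * r = (r - n)^2 - n^2\<close>.\<close>
    then have ex: "2 * int (r choose 2) + (1 - 2 * int n) * int r = - (int n)\<^sup>2 + j\<^sup>2"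
      by (simp add: j_def power2_eq_square algebra_simps)
    have "(q\<^sup>2) ^ (r choose 2) * (q powi (1 - 2 * int n)) ^ r = q powi (2 * int (r choose 2)) * q powi ((1 - 2 * int n) * int r)"
      by (simp add: power_int_mult)
    also have "\<dots> = q powi (- (int n)\<^sup>2) * q powi (j\<^sup>2)"
      using q0 ex by (simp flip: power_int_add)
    finally have qr: "(q\<^sup>2) ^ (r choose 2) * (q powi (1 - 2 * int n)) ^ r = q powi (- (int n)\<^sup>2) * q powi (j\<^sup>2)" .
    have nr: "nat (int n + (int r - int n)) = r" by simp
    have "z ^ n * q powi (- (int n)\<^sup>2) * (qbinom (q\<^sup>2) (2 * n) r * (z powi j * q powi (j\<^sup>2)))
      = qbinom (q\<^sup>2) (2 * n) r * (z ^ n * z powi j) * (q powi (- (int n)\<^sup>2) * q powi (j\<^sup>2))"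
      by (simp only: mult_ac)
    also have "\<dots> = (q\<^sup>2) ^ (r choose 2) * qbinom (q\<^sup>2) (2 * n) r * x ^ r"
      unfolding zr qr[symmetric] x_def power_mult_distrib by (simp only: mult_ac)
    finally show "z ^ n * q powi (- (int n)\<^sup>2) * (qbinom (q\<^sup>2) (2 * n) (nat (int n + (int r - int n))) *
       (z powi (int r - int n) * q powi ((int r - int n)\<^sup>2))) = (q\<^sup>2) ^ (r choose 2) * qbinom (q\<^sup>2) (2 * n) r * x ^ r"
      unfolding nr j_def .
  qed auto
  finally have "z ^ n * q powi (- (int n)\<^sup>2) * ((\<Prod>k<n. 1 + z * q * (q\<^sup>2) ^ k) * (\<Prod>k<n. 1 + q / z * (q\<^sup>2) ^ k)) =
     z ^ n * q powi (- (int n)\<^sup>2) * (\<Sum>j = - int n..int n. qbinom (q\<^sup>2) (2 * n) (nat (int n + j)) * (z powi j * q powi (j\<^sup>2)))"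
    unfolding P sum_distrib_left .
  moreover have "z ^ n * q powi (- (int n)\<^sup>2) \<noteq> 0" using z q0 by (simp add: power_int_eq_0_iff)
  ultimately show ?thesis unfolding mult_cancel_left by blast
qed

section \<open>The limit of the finite triple product\<close>

lemma qfact_lim:
  assumes "0 < y" "y < 1"
  shows "qfact y \<longlonglongrightarrow> qpochhammer_inf y y"
  using qpochhammer_lim[OF assms, of y] by (simp add: qfact_def[abs_def])

lemma qfact_antimono:
  assumes "0 < y" "y < 1"
  shows "decseq (qfact y)"
proof (rule decseq_SucI)
  fix n
  have "1 - y ^ Suc n \<le> 1" using assms by simp
  from mult_left_mono[OF this, of "qfact y n"] show "qfact y (Suc n) \<le> qfact y n"
    using qfact_pos[OF assms, of n] by (simp add: qfact_Suc)
qed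

text \<open>A bound independent of n and j, as needed for a majorant: \<open>qfact\<close> decreases
  to a positive limit.\<close>

lemma qbinom_le:
  assumes "0 < y" "y < 1"
  shows "0 \<le> qbinom y n j" "qbinom y n j \<le> 1 / qpochhammer_inf y y"
proof -
  have P: "qpochhammer_inf y y > 0" using assms by (intro qpochhammer_pos) auto
  have q: "qfact y k > 0" for k by (rule qfact_pos[OF assms])
  show "0 \<le> qbinom y n j" using q by (simp add: qbinom_def less_imp_le)
  show "qbinom y n j \<le> 1 / qpochhammer_inf y y"
  proof (cases "j \<le> n")
    case True
    have "qfact y n \<le> qfact y j" using qfact_antimono[OF assms] True by (auto simp: decseq_def)
    then have "qbinom y n j \<le> qfact y j / (qfact y j * qfact y (n - j))"
      unfolding qbinom_def if_P[OF True] using q by (intro divide_right_mono) (auto intro: less_imp_le)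
    also have "\<dots> = 1 / qfact y (n - j)" using q[of j] by simp
    also have "\<dots> \<le> 1 / qpochhammer_inf y y"
      using decseq_ge[OF qfact_antimono[OF assms] qfact_lim[OF assms], of "n - j"] P q
      by (intro divide_left_mono) auto
    finally show ?thesis .
  qed (use P in \<open>simp add: qbinom_def\<close>)
qed

lemma qbinom_central_lim:
  assumes "0 < y" "y < 1"
  shows "(\<lambda>n. qbinom y (2 * n) (nat (int n + j))) \<longlonglongrightarrow> 1 / qpochhammer_inf y y"
proof -
  let ?P = "qpochhammer_inf y y"
  have P: "?P > 0" using assms by (intro qpochhammer_pos) auto
  have shift: "filterlim (\<lambda>n. nat (int n + i)) at_top sequentially" for i
  proof (rule filterlim_at_top_mono)
    show "filterlim (\<lambda>n. n - nat \<bar>i\<bar>) at_top sequentially" by (rule filterlim_minus_const_nat_at_top)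
    show "eventually (\<lambda>n. n - nat \<bar>i\<bar> \<le> nat (int n + i)) sequentially"
      by (rule always_eventually) auto
  qed
  have l: "(\<lambda>n. qfact y (nat (int n + i))) \<longlonglongrightarrow> ?P" for i
    by (rule filterlim_compose[OF qfact_lim[OF assms] shift])
  have l2: "(\<lambda>n. qfact y (2 * n)) \<longlonglongrightarrow> ?P"
    by (rule filterlim_compose[OF qfact_lim[OF assms]]) (intro filterlim_subseq, simp add: strict_mono_def)
  have "(\<lambda>n. qfact y (2 * n) / (qfact y (nat (int n + j)) * qfact y (nat (int n + - j)))) \<longlonglongrightarrow> ?P / (?P * ?P)"
    using P by (intro tendsto_divide tendsto_mult l l2) auto
  then have "(\<lambda>n. qfact y (2 * n) / (qfact y (nat (int n + j)) * qfact y (nat (int n + - j)))) \<longlonglongrightarrow> 1 / ?P"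
    using P by simp
  then show ?thesis
  proof (rule Lim_transform_eventually)
    show "eventually (\<lambda>n. qfact y (2 * n) / (qfact y (nat (int n + j)) * qfact y (nat (int n + - j)))
      = qbinom y (2 * n) (nat (int n + j))) sequentially"
      using eventually_ge_at_top[of "nat \<bar>j\<bar>"]
    proof eventually_elim
      case (elim n)
      then have "nat (int n + j) \<le> 2 * n" "2 * n - nat (int n + j) = nat (int n + - j)" by auto
      then show ?case by (simp only: qbinom_def if_True)
    qed
  qed
qed

lemma power_int_eq_exp:
  assumes "(x::real) > 0"
  shows "x powi n = exp (of_int n * ln x)"
  using exp_power_int[of "ln x" n] assms by simp

theorem jacobi_triple_product:
  fixes q z :: real
  assumes q: "0 < q" "q < 1" and z: "z \<noteq> 0"
  shows "(\<Sum>\<^sub>\<infinity>j. z powi j * q powi (j\<^sup>2))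
    = qpochhammer_inf (q\<^sup>2) (q\<^sup>2) * qpochhammer_inf (- (z * q)) (q\<^sup>2) * qpochhammer_inf (- (q / z)) (q\<^sup>2)"
proof -
  define y where "y = q\<^sup>2"
  have y: "0 < y" "y < 1" using q by (auto simp: y_def power_less_one_iff)
  have P: "qpochhammer_inf y y > 0" using y by (intro qpochhammer_pos) auto
  define f where "f n j = (if j \<in> {- int n..int n} then qbinom y (2 * n) (nat (int n + j)) * (z powi j * q powi (j\<^sup>2)) else 0)" for n j
  have "(\<lambda>n. infsum (f n) UNIV) \<longlonglongrightarrow> infsum (\<lambda>j. 1 / qpochhammer_inf y y * (z powi j * q powi (j\<^sup>2))) UNIV"
  \<comment> \<open>The absolute value of z admits \<open>z = - 1\<close>, the case of
    \<open>jacobi4\<close>; \<open>- ln q > 0\<close> supplies the Gaussian decay.\<close>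
  proof (rule tannery_int[where N = 0 and M = "\<lambda>j. 1 / qpochhammer_inf y y * exp (\<bar>ln \<bar>z\<bar>\<bar> * \<bar>of_int j\<bar> - (- ln q) * (of_int j)\<^sup>2)"])
    fix j
    have "(\<lambda>n. qbinom y (2 * n) (nat (int n + j)) * (z powi j * q powi (j\<^sup>2))) \<longlonglongrightarrow> 1 / qpochhammer_inf y y * (z powi j * q powi (j\<^sup>2))"
      by (intro tendsto_mult tendsto_const qbinom_central_lim y)
    then show "(\<lambda>n. f n j) \<longlonglongrightarrow> 1 / qpochhammer_inf y y * (z powi j * q powi (j\<^sup>2))"
    proof (rule Lim_transform_eventually)
      show "eventually (\<lambda>n. qbinom y (2 * n) (nat (int n + j)) * (z powi j * q powi (j\<^sup>2)) = f n j) sequentially"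
        using eventually_ge_at_top[of "nat \<bar>j\<bar>"] by eventually_elim (auto simp: f_def)
    qed
  next
    fix n :: nat and j
    have "\<bar>f n j\<bar> \<le> \<bar>qbinom y (2 * n) (nat (int n + j)) * (z powi j * q powi (j\<^sup>2))\<bar>"
      by (simp add: f_def)
    also have "\<dots> = qbinom y (2 * n) (nat (int n + j)) * (\<bar>z\<bar> powi j * q powi (j\<^sup>2))"
      using qbinom_le(1)[OF y] q by (simp add: abs_mult power_int_abs)
    also have "\<bar>z\<bar> powi j * q powi (j\<^sup>2) = exp (of_int j * ln \<bar>z\<bar> + (of_int j)\<^sup>2 * ln q)"
      using z q by (simp add: power_int_eq_exp exp_add)
    also have "qbinom y (2 * n) (nat (int n + j)) * \<dots> \<le> 1 / qpochhammer_inf y y * exp (\<bar>ln \<bar>z\<bar>\<bar> * \<bar>of_int j\<bar> - (- ln q) * (of_int j)\<^sup>2)"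
    proof (intro mult_mono qbinom_le y)
      have "of_int j * ln \<bar>z\<bar> \<le> \<bar>of_int j * ln \<bar>z\<bar>\<bar>" by (rule abs_ge_self)
      also have "\<dots> = \<bar>ln \<bar>z\<bar>\<bar> * \<bar>of_int j\<bar>" by (simp add: abs_mult)
      finally show "exp (of_int j * ln \<bar>z\<bar> + (of_int j)\<^sup>2 * ln q) \<le> exp (\<bar>ln \<bar>z\<bar>\<bar> * \<bar>of_int j\<bar> - (- ln q) * (of_int j)\<^sup>2)"
        by (simp add: mult.commute)
    qed (use P in auto)
    finally show "\<bar>f n j\<bar> \<le> 1 / qpochhammer_inf y y * exp (\<bar>ln \<bar>z\<bar>\<bar> * \<bar>of_int j\<bar> - (- ln q) * (of_int j)\<^sup>2)" .
  next
    show "(\<lambda>j. 1 / qpochhammer_inf y y * exp (\<bar>ln \<bar>z\<bar>\<bar> * \<bar>of_int j\<bar> - (- ln q) * (of_int j)\<^sup>2)) summable_on UNIV"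
      using q by (intro summable_on_cmult_right summable_on_int_gauss) (simp add: ln_less_zero)
  qed
  moreover have "infsum (f n) UNIV = (\<Prod>k<n. 1 - (- (z * q)) * y ^ k) * (\<Prod>k<n. 1 - (- (q / z)) * y ^ k)" for n
  proof -
    have "infsum (f n) UNIV = infsum (f n) {- int n..int n}"
      by (rule infsum_cong_neutral) (auto simp: f_def)
    also have "\<dots> = (\<Sum>j = - int n..int n. qbinom (q\<^sup>2) (2 * n) (nat (int n + j)) * (z powi j * q powi (j\<^sup>2)))"
      by (simp add: f_def y_def)
    also have "\<dots> = (\<Prod>k<n. 1 + z * q * (q\<^sup>2) ^ k) * (\<Prod>k<n. 1 + q / z * (q\<^sup>2) ^ k)"
      by (rule jacobi_triple_finite[OF q z, symmetric])
    finally show ?thesis by (simp add: y_def)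
  qed
  moreover have "(\<lambda>n. (\<Prod>k<n. 1 - (- (z * q)) * y ^ k) * (\<Prod>k<n. 1 - (- (q / z)) * y ^ k))
      \<longlonglongrightarrow> qpochhammer_inf (- (z * q)) y * qpochhammer_inf (- (q / z)) y"
    by (intro tendsto_mult qpochhammer_lim y)
  ultimately have "infsum (\<lambda>j. 1 / qpochhammer_inf y y * (z powi j * q powi (j\<^sup>2))) UNIV
     = qpochhammer_inf (- (z * q)) y * qpochhammer_inf (- (q / z)) y"
    by (simp only:) (rule LIMSEQ_unique)
  then have "1 / qpochhammer_inf y y * (\<Sum>\<^sub>\<infinity>j. z powi j * q powi (j\<^sup>2)) = qpochhammer_inf (- (z * q)) y * qpochhammer_inf (- (q / z)) y"
    by (simp only: infsum_cmult_right')
  then show ?thesis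
    unfolding y_def[symmetric] using P by (simp add: field_simps)
qed

section \<open>Product formulas and degree 5\<close>

context
  fixes t q :: real
  assumes t: "t > 0" and q_def: "q = exp (- pi * t)"
begin

lemma nome: "0 < q" "q < 1" "0 < q\<^sup>2" "q\<^sup>2 < 1"
  using t by (auto simp: q_def power_less_one_iff)

lemma nome_powi: "q powi n = exp (- pi * t * of_int n)"
  unfolding q_def exp_power_int by (simp add: mult_ac)

lemma jacobi3_product: "jacobi3 t = qpochhammer_inf (q\<^sup>2) (q\<^sup>2) * (qpochhammer_inf (- q) (q\<^sup>2))\<^sup>2"
proof -
  have "jacobi3 t = (\<Sum>\<^sub>\<infinity>j. 1 powi j * q powi (j\<^sup>2))"
    by (simp add: jacobi3_def theta_def nome_powi)
  also have "\<dots> = qpochhammer_inf (q\<^sup>2) (q\<^sup>2) * qpochhammer_inf (- (1 * q)) (q\<^sup>2) * qpochhammer_inf (- (q / 1)) (q\<^sup>2)"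
    by (rule jacobi_triple_product) (use nome in auto)
  finally show ?thesis by (simp add: power2_eq_square[of "qpochhammer_inf _ _"])
qed

lemma jacobi4_product: "jacobi4 t = qpochhammer_inf (q\<^sup>2) (q\<^sup>2) * (qpochhammer_inf q (q\<^sup>2))\<^sup>2"
proof -
  have "jacobi4 t = (\<Sum>\<^sub>\<infinity>j. (- 1) powi j * q powi (j\<^sup>2))"
    unfolding jacobi4_sum[OF t] by (intro infsum_cong) (simp add: nome_powi power_int_minus_left)
  also have "\<dots> = qpochhammer_inf (q\<^sup>2) (q\<^sup>2) * qpochhammer_inf (- ((- 1) * q)) (q\<^sup>2) * qpochhammer_inf (- (q / (- 1))) (q\<^sup>2)"
    by (rule jacobi_triple_product) (use nome in auto)
  finally show ?thesis by (simp add: power2_eq_square[of "qpochhammer_inf _ _"])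
qed

text \<open>Since \<open>(j + 1/2)^2 = j^2 + j + 1/4\<close>, this is the case \<open>z = q\<close>.
  The product at \<open>- (q / z) = - 1\<close> begins with the factor 2.\<close>

lemma jacobi2_product:
  "jacobi2 t = 2 * exp (- pi * t / 4) * qpochhammer_inf (q\<^sup>2) (q\<^sup>2) * (qpochhammer_inf (- (q\<^sup>2)) (q\<^sup>2))\<^sup>2"
proof -
  have "exp (- (pi * t) * (of_int j + 1 / 2)\<^sup>2) = exp (- pi * t / 4) * (q powi j * q powi (j\<^sup>2))" for j :: int
    unfolding nome_powi exp_add[symmetric] by (simp add: power2_eq_square algebra_simps)
  then have "jacobi2 t = exp (- pi * t / 4) * (\<Sum>\<^sub>\<infinity>j. q powi j * q powi (j\<^sup>2))"
    unfolding jacobi2_shift by (simp only: infsum_cmult_right')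
  also have "(\<Sum>\<^sub>\<infinity>j. q powi j * q powi (j\<^sup>2)) = qpochhammer_inf (q\<^sup>2) (q\<^sup>2) * qpochhammer_inf (- (q * q)) (q\<^sup>2) * qpochhammer_inf (- (q / q)) (q\<^sup>2)"
    by (rule jacobi_triple_product) (use nome in auto)
  also have "- (q / q) = - 1" using nome by simp
  also have "qpochhammer_inf (- 1) (q\<^sup>2) = 2 * qpochhammer_inf (- (q\<^sup>2)) (q\<^sup>2)"
    using qpochhammer_Suc[OF nome(3,4), of "- 1"] by simp
  finally show ?thesis by (simp add: power2_eq_square)
qed

text \<open>For \<open>n = 5 * m + r\<close> one has
  \<open>n^2 / 5 = 5 * m^2 + 2 * r * m + r^2 / 5\<close>: the triple product with q^5 in place of q
  and \<open>z = q powi (2 * r)\<close>.\<close>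

lemma theta_mod_5:
  assumes "0 \<le> r" "r < 5"
  shows "theta (t / 5) {n. n mod 5 = r} = exp (- pi * t * (of_int r)\<^sup>2 / 5) *
    (qpochhammer_inf (q ^ 10) (q ^ 10) * qpochhammer_inf (- (q powi (5 + 2 * r))) (q ^ 10) * qpochhammer_inf (- (q powi (5 - 2 * r))) (q ^ 10))"
proof -
  have q5: "0 < q ^ 5" "q ^ 5 < 1" using nome by (auto simp: power_less_one_iff)
  have "theta (t / 5) {n. n mod 5 = r} = (\<Sum>\<^sub>\<infinity>m. exp (- pi * t * (of_int r)\<^sup>2 / 5) * ((q powi (2 * r)) powi m * (q ^ 5) powi (m\<^sup>2)))"
    unfolding theta_def
  proof (rule infsum_reindex_bij_witness[of _ "\<lambda>m. 5 * m + r" "\<lambda>n. n div 5"])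
    fix n :: int assume n: "n \<in> {n. n mod 5 = r}"
    define m where "m = n div 5"
    have nm: "real_of_int n = 5 * of_int m + of_int r"
    proof -
      have "n = 5 * m + r" using n by (auto simp: m_def)
      then show ?thesis by simp
    qed
    have "(q powi (2 * r)) powi m * (q ^ 5) powi (m\<^sup>2) = exp (- pi * t * (2 * of_int r * of_int m + 5 * (of_int m)\<^sup>2))"
    proof -
      have "(q powi (2 * r)) powi m = q powi (2 * r * m)" "(q ^ 5) powi (m\<^sup>2) = q powi (5 * m\<^sup>2)"
        by (simp_all add: power_int_mult)
      then show ?thesis unfolding nome_powi by (simp flip: exp_add add: algebra_simps)
    qed
    then show "exp (- pi * t * (of_int r)\<^sup>2 / 5) * ((q powi (2 * r)) powi (n div 5) * (q ^ 5) powi ((n div 5)\<^sup>2)) = exp (- pi * (t / 5) * (of_int n)\<^sup>2)"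
      unfolding m_def[symmetric] nm by (simp flip: exp_add) (simp add: power2_eq_square field_simps)
  qed (use assms in auto)
  also have "\<dots> = exp (- pi * t * (of_int r)\<^sup>2 / 5) * (\<Sum>\<^sub>\<infinity>m. (q powi (2 * r)) powi m * (q ^ 5) powi (m\<^sup>2))"
    by (rule infsum_cmult_right')
  also have "(\<Sum>\<^sub>\<infinity>m. (q powi (2 * r)) powi m * (q ^ 5) powi (m\<^sup>2)) = qpochhammer_inf ((q ^ 5)\<^sup>2) ((q ^ 5)\<^sup>2) *
      qpochhammer_inf (- (q powi (2 * r) * q ^ 5)) ((q ^ 5)\<^sup>2) * qpochhammer_inf (- (q ^ 5 / q powi (2 * r))) ((q ^ 5)\<^sup>2)"
    by (rule jacobi_triple_product) (use q5 nome in auto)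
  also have "q powi (2 * r) * q ^ 5 = q powi (5 + 2 * r)"
    using nome by (simp add: power_int_add)
  also have "q ^ 5 / q powi (2 * r) = q powi (5 - 2 * r)"
    using nome by (simp add: power_int_diff)
  also have "(q ^ 5)\<^sup>2 = q ^ 10" by simp
  finally show ?thesis .
qed

text \<open>Up to the factor 2^(1/4) q^(1/24), \<open>qpochhammer_inf (- q) (q^2)\<close> is
  Ramanujan's class invariant. Through Euler's identity its sixth power is expressed by theta
  constants.\<close>

lemma jacobi_modulus_product: "jacobi2 t * jacobi4 t * qpochhammer_inf (- q) (q\<^sup>2) ^ 6 = 2 * exp (- pi * t / 4) * (jacobi3 t)\<^sup>2"
proof -
  define a b c P where "a = qpochhammer_inf (- (q\<^sup>2)) (q\<^sup>2)" and "b = qpochhammer_inf q (q\<^sup>2)"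
    and "c = qpochhammer_inf (- q) (q\<^sup>2)" and "P = qpochhammer_inf (q\<^sup>2) (q\<^sup>2)"
  have eq: "2 * e * P * a\<^sup>2 * (P * b\<^sup>2) * c ^ 6 = 2 * e * (P * c\<^sup>2)\<^sup>2 * (a * b * c)\<^sup>2" for e
    by (simp add: power_mult_distrib power2_eq_square numeral_eq_Suc)
  have abc: "a * b * c = 1"
    unfolding a_def b_def c_def by (rule qpochhammer_euler[OF nome(1,2)])
  show ?thesis
    unfolding jacobi2_product jacobi3_product jacobi4_product a_def[symmetric] b_def[symmetric] c_def[symmetric] P_def[symmetric] eq abc
    by simp
qed

text \<open>In the quotient of the products for \<open>jacobi2\<close> and \<open>jacobi4\<close>
  the factor \<open>qpochhammer_inf (q^2) (q^2)\<close> cancels, leaving twice the square of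
  \<open>S2 q\<close>.\<close>

lemma S2_eq_sqrt: "S2 q = sqrt (jacobi_ratio t / 2)"
proof (rule real_sqrt_unique[symmetric])
  have r: "root 8 q = exp (- pi * t / 8)"
  proof (rule real_root_pos_unique)
    show "exp (- pi * t / 8) ^ 8 = q" unfolding q_def by (simp flip: exp_of_nat_mult)
  qed auto
  have r2: "(exp (- pi * t / 8))\<^sup>2 = exp (- pi * t / 4)"
    by (simp flip: exp_of_nat_mult)
  have pos: "qpochhammer_inf (q\<^sup>2) (q\<^sup>2) > 0" "qpochhammer_inf q (q\<^sup>2) > 0" "qpochhammer_inf (- (q\<^sup>2)) (q\<^sup>2) > 0"
  proof -
    have "- (q\<^sup>2) < 1" using nome(3) by linarith
    then show "qpochhammer_inf (- (q\<^sup>2)) (q\<^sup>2) > 0" by (rule qpochhammer_pos[OF nome(3,4)])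
    show "qpochhammer_inf (q\<^sup>2) (q\<^sup>2) > 0" "qpochhammer_inf q (q\<^sup>2) > 0"
      using nome by (simp_all add: qpochhammer_pos)
  qed
  show "(S2 q)\<^sup>2 = jacobi_ratio t / 2"
    using pos unfolding S2_def r jacobi_ratio_def jacobi2_product jacobi4_product power_divide power_mult_distrib r2
    by (simp add: field_simps)
  show "S2 q \<ge> 0" using pos nome by (simp add: S2_def)
qed

end

text \<open>The classes 1 and 2 mod 5 give the products for the exponents 1, 3, 7, 9 mod 10. The
  missing one for 5 completes them to the product over all odd exponents.\<close>

lemma jacobi3_sq_diff_product:
  assumes t: "t > 0" and q: "q = exp (- pi * t)"
  shows "((jacobi3 t)\<^sup>2 - (jacobi3 (5 * t))\<^sup>2) * qpochhammer_inf (- (q ^ 5)) (q ^ 10) ^ 5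
    = 4 * q * qpochhammer_inf (- q) (q\<^sup>2) * (jacobi3 (5 * t))\<^sup>2"
proof -
  define X where "X k = qpochhammer_inf (- (q ^ k)) (q ^ 10)" for k
  define P where "P = qpochhammer_inf (q ^ 10) (q ^ 10)"
  note nome = nome[OF t q]
  have q5: "q ^ 5 = exp (- pi * (5 * t))" unfolding q by (simp flip: exp_of_nat_mult add: algebra_simps)
  have e: "(q ^ 5)\<^sup>2 = q ^ 10" by simp
  have j5: "jacobi3 (5 * t) = P * (X 5)\<^sup>2"
    using jacobi3_product[OF mult_pos_pos[OF zero_less_numeral t] q5] unfolding X_def P_def e .
  have "qpochhammer_inf (- q) (q\<^sup>2) = (\<Prod>r<5. qpochhammer_inf (- q * (q\<^sup>2) ^ r) ((q\<^sup>2) ^ 5))"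
    by (rule qpochhammer_regroup[OF nome(3,4)]) simp
  also have "\<dots> = (\<Prod>r<5. X (2 * r + 1))"
    by (intro prod.cong refl) (simp add: X_def flip: power_mult)
  also have "\<dots> = X 1 * X 3 * X 5 * X 7 * X 9"
    by (simp add: numeral_eq_Suc lessThan_Suc mult_ac)
  finally have c: "qpochhammer_inf (- q) (q\<^sup>2) = X 1 * X 3 * X 5 * X 7 * X 9" .
  have pw: "q powi 7 = q ^ 7" "q powi 3 = q ^ 3" "q powi 9 = q ^ 9" "q powi 1 = q ^ 1"
    using nome by (simp_all add: power_int_def)
  have "theta (t / 5) {n. n mod 5 = 1} = exp (- pi * t / 5) * (P * X 7 * X 3)"
    using theta_mod_5[OF t q, of 1] pw by (simp add: X_def P_def)
  moreover have "theta (t / 5) {n. n mod 5 = 2} = exp (- pi * t * 4 / 5) * (P * X 9 * X 1)"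
    using theta_mod_5[OF t q, of 2] pw by (simp add: X_def P_def)
  moreover have "exp (- pi * t / 5) * exp (- pi * t * 4 / 5) = q"
    unfolding q by (simp flip: exp_add)
  ultimately have "(jacobi3 t)\<^sup>2 - (jacobi3 (5 * t))\<^sup>2 = 4 * q * (P\<^sup>2 * X 1 * X 3 * X 7 * X 9)"
    using theta_degree_5[OF t] unfolding jacobi3_def by (simp add: power2_eq_square mult_ac)
  then show ?thesis
    unfolding c unfolding j5 X_def[symmetric] by (simp add: power_mult_distrib power2_eq_square numeral_eq_Suc)
qed

text \<open>The square root of k k'. Inversion exchanges k and k'.\<close>

definition jacobi_modulus :: "real \<Rightarrow> real"
  where "jacobi_modulus t = jacobi2 t * jacobi4 t / (jacobi3 t)\<^sup>2"

lemma jacobi_modulus_pos: "t > 0 \<Longrightarrow> jacobi_modulus t > 0"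
  unfolding jacobi_modulus_def
  by (intro divide_pos_pos mult_pos_pos zero_less_power jacobi2_pos jacobi3_pos jacobi4_pos)

lemma jacobi_modulus_inversion:
  assumes "t > 0"
  shows "jacobi_modulus (1 / t) = jacobi_modulus t"
proof -
  have "jacobi2 (1 / t) * jacobi4 (1 / t) = (sqrt t * sqrt t) * (jacobi2 t * jacobi4 t)"
    unfolding jacobi2_inversion[OF assms] jacobi4_inversion[OF assms] by (simp only: mult_ac)
  then have "jacobi2 (1 / t) * jacobi4 (1 / t) = t * (jacobi2 t * jacobi4 t)"
    using assms by simp
  then show ?thesis
    using assms by (simp add: jacobi_modulus_def jacobi3_inversion power_mult_distrib)
qed

text \<open>In the sixth power of the product identity only c^6 and c5^30 occur, which
  \<open>jacobi_modulus_product\<close> replaces by theta constants; the powers of the nome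
  cancel.\<close>

lemma jacobi_degree_5:
  assumes t: "t > 0"
  shows "((jacobi3 t)\<^sup>2 - (jacobi3 (5 * t))\<^sup>2) ^ 6 * jacobi_modulus t = 256 * jacobi_modulus (5 * t) ^ 5 * jacobi3 (5 * t) ^ 12"
proof -
  define q where "q = exp (- pi * t)"
  have q5: "q ^ 5 = exp (- pi * (5 * t))" unfolding q_def by (simp flip: exp_of_nat_mult add: algebra_simps)
  have t5: "5 * t > 0" using t by simp
  define D where "D = (jacobi3 t)\<^sup>2 - (jacobi3 (5 * t))\<^sup>2"
  define c c5 where "c = qpochhammer_inf (- q) (q\<^sup>2)" and "c5 = qpochhammer_inf (- (q ^ 5)) (q ^ 10)"
  define e where "e = exp (- pi * t / 4)"
  have e4: "e ^ 4 = q" unfolding e_def q_def by (simp flip: exp_of_nat_mult)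
  have e5: "exp (- pi * (5 * t) / 4) = e ^ 5" unfolding e_def by (simp flip: exp_of_nat_mult)
  have j: "jacobi3 t > 0" "jacobi3 (5 * t) > 0" using t t5 by (simp_all add: jacobi3_pos)
  have c5: "c5 > 0"
  proof -
    have "0 < q ^ 5" "0 < q ^ 10" "q ^ 10 < 1"
      using nome[OF t q_def] by (auto simp: power_less_one_iff)
    moreover from this have "- (q ^ 5) < 1" by linarith
    ultimately show ?thesis unfolding c5_def by (intro qpochhammer_pos)
  qed
  have D: "D * c5 ^ 5 = 4 * e ^ 4 * c * (jacobi3 (5 * t))\<^sup>2"
    unfolding D_def c_def c5_def e4 by (rule jacobi3_sq_diff_product[OF t q_def])
  have G: "jacobi_modulus t * c ^ 6 = 2 * e"
    using jacobi_modulus_product[OF t q_def] j unfolding jacobi_modulus_def c_def e_def by (simp add: field_simps)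
  have G5: "jacobi_modulus (5 * t) * c5 ^ 6 = 2 * e ^ 5"
  proof -
    have "(q ^ 5)\<^sup>2 = q ^ 10" by simp
    then show ?thesis
      using jacobi_modulus_product[OF t5 q5] j unfolding jacobi_modulus_def c5_def e5 by (simp add: field_simps)
  qed
  have "D ^ 6 * jacobi_modulus t * c5 ^ 30 = (D * c5 ^ 5) ^ 6 * jacobi_modulus t"
    by (simp add: power_mult_distrib flip: power_mult)
  also have "\<dots> = 4096 * e ^ 24 * jacobi3 (5 * t) ^ 12 * (jacobi_modulus t * c ^ 6)"
    unfolding D by (simp add: power_mult_distrib flip: power_mult)
  also have "\<dots> = 256 * (2 * e ^ 5) ^ 5 * jacobi3 (5 * t) ^ 12"
    unfolding G by (simp add: power_mult_distrib flip: power_mult power_Suc2)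
  also have "\<dots> = 256 * jacobi_modulus (5 * t) ^ 5 * jacobi3 (5 * t) ^ 12 * c5 ^ 30"
    unfolding G5[symmetric] by (simp add: power_mult_distrib flip: power_mult)
  finally show ?thesis unfolding D_def[symmetric] using c5 by simp
qed

text \<open>At \<open>1 / sqrt 5\<close> both values of \<open>jacobi_modulus\<close> agree and
  those of \<open>jacobi3\<close> are proportional, so for \<open>s = sqrt 5\<close> the equation
  collapses to \<open>(s - 1)^6 = 256 * G^4\<close>.\<close>

lemma jacobi_ratio_sqrt_5: "(jacobi_ratio (sqrt 5))\<^sup>2 + 1 / (jacobi_ratio (sqrt 5))\<^sup>2 = 2 * (2 + sqrt 5)"
proof -
  define s where "s = sqrt (5::real)"
  have s: "s > 0" "s\<^sup>2 = 5" "s > 2" by (simp_all add: s_def real_less_rsqrt)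
  have 5: "5 * (1 / s) = s" using s by (simp add: field_simps power2_eq_square)
  define j G where "j = jacobi3 s" and "G = jacobi_modulus s"
  have pos: "j > 0" "G > 0" using s by (simp_all add: j_def G_def jacobi3_pos jacobi_modulus_pos)
  have j1: "(jacobi3 (1 / s))\<^sup>2 = s * j\<^sup>2"
    using s by (simp add: jacobi3_inversion j_def power_mult_distrib)
  have "(s * j\<^sup>2 - j\<^sup>2) ^ 6 * G = 256 * G ^ 5 * j ^ 12"
    using jacobi_degree_5[of "1 / s"] s unfolding 5 j1 by (simp add: jacobi_modulus_inversion j_def G_def)
  moreover have "(s * j\<^sup>2 - j\<^sup>2) ^ 6 = (s - 1) ^ 6 * j ^ 12"
  proof -
    have "s * j\<^sup>2 - j\<^sup>2 = (s - 1) * j\<^sup>2" by (simp add: algebra_simps)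
    then show ?thesis by (simp add: power_mult_distrib flip: power_mult)
  qed
  ultimately have "(j ^ 12 * G) * (s - 1) ^ 6 = (j ^ 12 * G) * (256 * G ^ 4)"
    by (simp add: numeral_eq_Suc mult_ac)
  then have "((s - 1) ^ 3)\<^sup>2 = (16 * G\<^sup>2)\<^sup>2"
    unfolding mult_cancel_left using pos by (simp add: power_mult_distrib flip: power_mult)
  then have "(s - 1) ^ 3 = 16 * G\<^sup>2"
    using s by (subst (asm) power2_eq_iff_nonneg) auto
  \<comment> \<open>Here \<open>(s - 1)^3 = 8 * (s - 2)\<close>, and
    \<open>(s - 2) * (s + 2) = 1\<close> inverts it.\<close>
  moreover have "(s - 1) ^ 3 * (2 * (2 + s)) = 16"
  proof -
    have "(s - 1) ^ 3 = s * s\<^sup>2 - 3 * s\<^sup>2 + 3 * s - 1"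
      by (simp add: power3_eq_cube power2_eq_square algebra_simps)
    also have "\<dots> = 8 * (s - 2)" unfolding s(2) by simp
    also have "8 * (s - 2) * (2 * (2 + s)) = 16 * (s\<^sup>2 - 4)"
      by (simp add: power2_eq_square algebra_simps)
    finally show ?thesis unfolding s(2) by simp
  qed
  ultimately have "16 * (G\<^sup>2 * (2 * (2 + s))) = 16"
    by simp
  then have "1 / G\<^sup>2 = 2 * (2 + s)" using pos by (simp add: field_simps)
  moreover have "(jacobi_ratio s)\<^sup>2 + 1 / (jacobi_ratio s)\<^sup>2 = 1 / G\<^sup>2"
    unfolding jacobi_ratio_sq_plus_inverse[OF s(1)] G_def jacobi_modulus_def by (simp add: power_divide)
  ultimately show ?thesis unfolding s_def by simp
qed

section \<open>Special values\<close>

text \<open>Each factor of the numerator grows with q and each factor of the denominator shrinks.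
  Limits keep only weak inequalities, so strictness comes from \<open>root 8\<close>.\<close>

lemma S2_strict_mono:
  assumes "0 < p" "p < q" "q < 1"
  shows "S2 p < S2 q"
proof -
  have sq: "0 < p\<^sup>2" "p\<^sup>2 < 1" "0 < q\<^sup>2" "q\<^sup>2 < 1" "p\<^sup>2 \<le> q\<^sup>2"
    using assms by (auto simp: power_less_one_iff intro: power_mono)
  have k: "(p\<^sup>2) ^ k \<le> (q\<^sup>2) ^ k" "0 < (p\<^sup>2) ^ k" "(q\<^sup>2) ^ k \<le> 1" for k
    using sq by (auto intro: power_mono power_le_one)
  have "qpochhammer_inf (- (p\<^sup>2)) (p\<^sup>2) \<le> qpochhammer_inf (- (q\<^sup>2)) (q\<^sup>2)"
  proof (rule LIMSEQ_le[OF qpochhammer_lim qpochhammer_lim])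
    have "(\<Prod>k<n. 1 - (- (p\<^sup>2)) * (p\<^sup>2) ^ k) \<le> (\<Prod>k<n. 1 - (- (q\<^sup>2)) * (q\<^sup>2) ^ k)" for n
    proof (rule prod_mono, rule conjI)
      fix i
      have "p\<^sup>2 * (p\<^sup>2) ^ i \<le> q\<^sup>2 * (q\<^sup>2) ^ i" using sq k by (intro mult_mono) auto
      then show "1 - (- (p\<^sup>2)) * (p\<^sup>2) ^ i \<le> 1 - (- (q\<^sup>2)) * (q\<^sup>2) ^ i" by simp
      have "0 \<le> p\<^sup>2 * (p\<^sup>2) ^ i" by simp
      then show "0 \<le> 1 - (- (p\<^sup>2)) * (p\<^sup>2) ^ i" by simp
    qed
    then show "\<exists>N. \<forall>n\<ge>N. (\<Prod>k<n. 1 - (- (p\<^sup>2)) * (p\<^sup>2) ^ k) \<le> (\<Prod>k<n. 1 - (- (q\<^sup>2)) * (q\<^sup>2) ^ k)" by blast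
  qed (use sq in auto)
  moreover have "qpochhammer_inf q (q\<^sup>2) \<le> qpochhammer_inf p (p\<^sup>2)"
  proof (rule LIMSEQ_le[OF qpochhammer_lim qpochhammer_lim])
    have "(\<Prod>k<n. 1 - q * (q\<^sup>2) ^ k) \<le> (\<Prod>k<n. 1 - p * (p\<^sup>2) ^ k)" for n
    proof (rule prod_mono, rule conjI)
      fix i
      have "p * (p\<^sup>2) ^ i \<le> q * (q\<^sup>2) ^ i" using assms k by (intro mult_mono) auto
      then show "1 - q * (q\<^sup>2) ^ i \<le> 1 - p * (p\<^sup>2) ^ i" by simp
      have "q * (q\<^sup>2) ^ i \<le> 1 * 1" using assms k sq by (intro mult_mono) auto
      then show "0 \<le> 1 - q * (q\<^sup>2) ^ i" by simp
    qed
    then show "\<exists>N. \<forall>n\<ge>N. (\<Prod>k<n. 1 - q * (q\<^sup>2) ^ k) \<le> (\<Prod>k<n. 1 - p * (p\<^sup>2) ^ k)" by blast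
  qed (use sq in auto)
  moreover have "root 8 p < root 8 q" using assms by (simp add: real_root_less_mono)
  moreover have "qpochhammer_inf q (q\<^sup>2) > 0" "root 8 p > 0"
    using assms sq by (auto intro: qpochhammer_pos)
  moreover have "qpochhammer_inf (- (p\<^sup>2)) (p\<^sup>2) > 0"
  proof -
    have "- (p\<^sup>2) < 1" using sq(1) by linarith
    then show ?thesis by (rule qpochhammer_pos[OF sq(1,2)])
  qed
  ultimately show ?thesis
    unfolding S2_def by (intro frac_less mult_less_le_imp_less) auto
qed

lemma jacobi_ratio_antimono:
  assumes "0 < s" "s < t"
  shows "jacobi_ratio t < jacobi_ratio s"
proof -
  have "S2 (exp (- pi * t)) < S2 (exp (- pi * s))"
    using assms by (intro S2_strict_mono) auto
  then show ?thesis
    using assms S2_eq_sqrt[of t, OF _ refl] S2_eq_sqrt[of s, OF _ refl] by simp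
qed

text \<open>The point 1 is fixed by inversion, so the positive ratio there equals its
  reciprocal.\<close>

lemma jacobi_ratio_less_1:
  assumes "t > 1"
  shows "jacobi_ratio t < 1"
proof -
  have "jacobi_ratio 1 * jacobi_ratio 1 = 1"
    using jacobi_ratio_inversion[of 1] jacobi_ratio_pos[of 1] by (simp add: field_simps)
  then have "jacobi_ratio 1 = 1"
    using jacobi_ratio_pos[of 1] by (simp add: square_eq_1_iff)
  then show ?thesis using jacobi_ratio_antimono[of 1 t] assms by simp
qed

text \<open>\<open>x + 1 / x\<close> takes the same value only at x and at \<open>1 / x\<close>, and
  these cannot both lie below 1.\<close>

lemma eq_if_sq_plus_inverse_eq:
  fixes u w :: real
  assumes "0 < u" "u < 1" "0 < w" "w < 1" "u\<^sup>2 + 1 / u\<^sup>2 = w\<^sup>2 + 1 / w\<^sup>2"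
  shows "u = w"
proof -
  have "(u\<^sup>2 - w\<^sup>2) * (u\<^sup>2 * w\<^sup>2 - 1) = 0"
    using assms by (simp add: field_simps power2_eq_square)
  moreover have "u\<^sup>2 * w\<^sup>2 < 1"
    using assms by (intro mult_strict_mono[of "u\<^sup>2" 1 "w\<^sup>2" 1, simplified]) (auto simp: power_less_one_iff)
  ultimately have "u\<^sup>2 = w\<^sup>2" by simp
  then show ?thesis using assms by (simp add: power2_eq_iff_nonneg)
qed

text \<open>Both \<open>jacobi_ratio (t / 3)\<close> and \<open>jacobi_ratio (3 * t)\<close> solve the degree 3 modular equation in which
  \<open>jacobi_ratio t\<close> is the other variable. Dividing by \<open>jacobi_ratio t\<close> turns it into a quartic whose coefficients
  involve only the square of \<open>jacobi_ratio t\<close>, and whose two positive roots form one quadratic factor.\<close>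

lemma jacobi_ratio_third_and_triple:
  fixes t k c d \<sigma> \<pi>' :: real
  assumes t: "t > 0" and k: "k > 0" and cd: "0 < d" "d < c" "c\<^sup>2 - d\<^sup>2 = 1"
    and nonneg: "\<sigma> \<ge> 0" "\<pi>' > 0"
    and factor: "\<And>x. x ^ 4 - 4 * (jacobi_ratio t)\<^sup>2 * x ^ 3 - 6 * x\<^sup>2 - 4 / (jacobi_ratio t)\<^sup>2 * x + 1
      = (x\<^sup>2 - k * (2 * (c\<^sup>2 + d\<^sup>2)) * x + k\<^sup>2) * (x\<^sup>2 + \<sigma> * x + \<pi>')"
  shows "jacobi_ratio (3 * t) = jacobi_ratio t * k * (c - d)\<^sup>2"
    and "jacobi_ratio (t / 3) = jacobi_ratio t * k * (c + d)\<^sup>2"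
proof -
  define u where "u = jacobi_ratio t"
  have u: "u > 0" unfolding u_def by (rule jacobi_ratio_pos) fact
  \<comment> \<open>The numbers \<open>k * (c - d)^2\<close> and \<open>k * (c + d)^2\<close> have
    product k^2 and sum \<open>2 * k * (c^2 + d^2)\<close>: they are the roots of the first
    quadratic factor.\<close>
  have cd1: "(c - d) * (c + d) = 1" using cd(3) by (simp add: power2_eq_square algebra_simps)
  have cdsq: "(c - d)\<^sup>2 * (c + d)\<^sup>2 = 1" using cd1 by (simp flip: power_mult_distrib)
  have root: "v = u * k * (c - d)\<^sup>2 \<or> v = u * k * (c + d)\<^sup>2"
    if "v > 0" "(1 + u ^ 4) * (1 + v ^ 4) = (1 + u * v) ^ 4" for v
  proof -
    define x where "x = v / u"
    have x: "x > 0" "v = u * x" using that u by (simp_all add: x_def)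
    have "u ^ 4 * (x ^ 4 - 4 * u\<^sup>2 * x ^ 3 - 6 * x\<^sup>2 - 4 / u\<^sup>2 * x + 1)
       = u ^ 4 * x ^ 4 - 4 * u ^ 6 * x ^ 3 - 6 * u ^ 4 * x\<^sup>2 - 4 * u\<^sup>2 * x + u ^ 4"
      using u by (simp add: field_simps power2_eq_square numeral_eq_Suc)
    also have "\<dots> = (1 + u ^ 4) * (1 + v ^ 4) - (1 + u * v) ^ 4"
      unfolding x(2) by (simp add: power2_eq_square numeral_eq_Suc algebra_simps)
    also have "\<dots> = 0" using that by simp
    finally have "(x\<^sup>2 - k * (2 * (c\<^sup>2 + d\<^sup>2)) * x + k\<^sup>2) * (x\<^sup>2 + \<sigma> * x + \<pi>') = 0"
      using u unfolding factor[folded u_def] by simp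
    moreover have "x\<^sup>2 + \<sigma> * x + \<pi>' > 0"
      using nonneg x by (intro add_nonneg_pos add_nonneg_nonneg) auto
    ultimately have "x\<^sup>2 - k * (2 * (c\<^sup>2 + d\<^sup>2)) * x + k\<^sup>2 = 0" by simp
    also have "x\<^sup>2 - k * (2 * (c\<^sup>2 + d\<^sup>2)) * x + k\<^sup>2 = x\<^sup>2 - k * (2 * (c\<^sup>2 + d\<^sup>2)) * x + k\<^sup>2 * ((c - d)\<^sup>2 * (c + d)\<^sup>2)"
      unfolding cdsq by simp
    also have "\<dots> = (x - k * (c - d)\<^sup>2) * (x - k * (c + d)\<^sup>2)"
      by (simp add: power2_eq_square algebra_simps)
    finally have "x = k * (c - d)\<^sup>2 \<or> x = k * (c + d)\<^sup>2" by simp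
    then show ?thesis unfolding x(2) by (auto simp: mult.assoc)
  qed
  have "(c - d)\<^sup>2 < (c + d)\<^sup>2" using cd by (intro power_strict_mono) auto
  then have lt: "u * k * (c - d)\<^sup>2 < u * k * (c + d)\<^sup>2" using u k by simp
  have r1: "jacobi_ratio (3 * t) = u * k * (c - d)\<^sup>2 \<or> jacobi_ratio (3 * t) = u * k * (c + d)\<^sup>2"
    using jacobi_ratio_degree_3[OF t] t by (intro root) (auto simp: u_def jacobi_ratio_pos)
  have r2: "jacobi_ratio (t / 3) = u * k * (c - d)\<^sup>2 \<or> jacobi_ratio (t / 3) = u * k * (c + d)\<^sup>2"
    using jacobi_ratio_degree_3[of "t / 3"] t by (intro root) (auto simp: u_def jacobi_ratio_pos mult.commute)
  have "jacobi_ratio (3 * t) < jacobi_ratio (t / 3)"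
    using t by (intro jacobi_ratio_antimono) auto
  then show "jacobi_ratio (3 * t) = jacobi_ratio t * k * (c - d)\<^sup>2" "jacobi_ratio (t / 3) = jacobi_ratio t * k * (c + d)\<^sup>2"
    using r1 r2 lt unfolding u_def[symmetric] by auto
qed

lemma S2_third_and_triple:
  fixes t w c d :: real
  assumes t: "t > 0" and w: "w \<ge> 0" and cd: "0 < d" "d < c"
    and triple: "jacobi_ratio (3 * t) = w\<^sup>2 * (c - d)\<^sup>2" and third: "jacobi_ratio (t / 3) = w\<^sup>2 * (c + d)\<^sup>2"
  shows "S2 (exp (- (3 * t * pi))) = 1 / sqrt 2 * w * (c - d)"
    and "S2 (exp (- (t * pi / 3))) = 1 / sqrt 2 * w * (c + d)"
proof -
  have S: "S2 (exp (- (s * pi))) = sqrt (jacobi_ratio s / 2)" if "s > 0" for s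
    by (rule S2_eq_sqrt[OF that]) (simp add: mult.commute)
  show "S2 (exp (- (3 * t * pi))) = 1 / sqrt 2 * w * (c - d)"
    using S[of "3 * t"] t w cd unfolding triple by (simp add: real_sqrt_divide real_sqrt_mult)
  show "S2 (exp (- (t * pi / 3))) = 1 / sqrt 2 * w * (c + d)"
    using S[of "t / 3"] t w cd unfolding third by (simp add: real_sqrt_divide real_sqrt_mult)
qed

text \<open>Comparing coefficients reduces a factorisation for all x to four identities between
  numbers.\<close>

lemma quartic_split:
  fixes x :: real
  assumes "\<sigma>' - \<sigma> = - (4 * A)" "\<pi>\<^sub>1 + \<pi>\<^sub>2 - \<sigma> * \<sigma>' = - 6" "\<sigma>' * \<pi>\<^sub>1 - \<sigma> * \<pi>\<^sub>2 = - B" "\<pi>\<^sub>1 * \<pi>\<^sub>2 = 1"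
  shows "x ^ 4 - 4 * A * x ^ 3 - 6 * x\<^sup>2 - B * x + 1 = (x\<^sup>2 - \<sigma> * x + \<pi>\<^sub>1) * (x\<^sup>2 + \<sigma>' * x + \<pi>\<^sub>2)"
proof -
  have "(x\<^sup>2 - \<sigma> * x + \<pi>\<^sub>1) * (x\<^sup>2 + \<sigma>' * x + \<pi>\<^sub>2)
    = x ^ 4 + (\<sigma>' - \<sigma>) * x ^ 3 + (\<pi>\<^sub>1 + \<pi>\<^sub>2 - \<sigma> * \<sigma>') * x\<^sup>2 + (\<sigma>' * \<pi>\<^sub>1 - \<sigma> * \<pi>\<^sub>2) * x + \<pi>\<^sub>1 * \<pi>\<^sub>2"
    by (simp add: power2_eq_square power3_eq_cube power4_eq_xxxx algebra_simps)
  then show ?thesis unfolding assms by simp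
qed

text \<open>r is the square root of the golden ratio. The two nested radicals have product
  \<open>r / 2\<close> and squares adding up to r^2, so everything becomes polynomial arithmetic
  modulo \<open>r^4 = r^2 + 1\<close>.\<close>

lemma sqrt_sqrt_5_expressions:
  defines "r \<equiv> sqrt ((1 + sqrt 5) / 2)"
  shows "r > 1" "r\<^sup>2 = (1 + sqrt 5) / 2" "r ^ 4 = r\<^sup>2 + 1"
    and "(sqrt ((sqrt 5 + 3) / 4) - sqrt ((sqrt 5 - 1) / 4))\<^sup>2 = r\<^sup>2 - r"
proof -
  have s5: "sqrt 5 > (2::real)" by (simp add: real_less_rsqrt)
  then show "r > 1" by (simp add: r_def)
  show r2: "r\<^sup>2 = (1 + sqrt 5) / 2" by (simp add: r_def)
  have "r ^ 4 = (r\<^sup>2)\<^sup>2" by simp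
  then show "r ^ 4 = r\<^sup>2 + 1" unfolding r2 by (simp add: power2_eq_square field_simps)
  have "r = sqrt (4 * ((sqrt 5 + 3) / 4 * ((sqrt 5 - 1) / 4)))"
    unfolding r_def by (intro arg_cong[of _ _ sqrt]) (simp add: field_simps)
  also have "\<dots> = 2 * (sqrt ((sqrt 5 + 3) / 4) * sqrt ((sqrt 5 - 1) / 4))"
    by (simp only: real_sqrt_mult) simp
  finally have r: "r = 2 * (sqrt ((sqrt 5 + 3) / 4) * sqrt ((sqrt 5 - 1) / 4))" .
  show "(sqrt ((sqrt 5 + 3) / 4) - sqrt ((sqrt 5 - 1) / 4))\<^sup>2 = r\<^sup>2 - r"
    unfolding power2_diff unfolding r2 using s5 r by (simp add: field_simps)
qed

text \<open>The number w has two roles: it is \<open>jacobi_ratio (sqrt 5)\<close> and also the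
  parameter k of the quadratic factor. The ratios at the two points are therefore the squares of
  \<open>w * (c - d)\<close> and \<open>w * (c + d)\<close>.\<close>

lemma S2_sqrt_5:
  defines "w \<equiv> (sqrt ((sqrt 5 + 3) / 4) - sqrt ((sqrt 5 - 1) / 4))\<^sup>2"
    and "c \<equiv> sqrt ((3 * sqrt 5 + 7) / 4)" and "d \<equiv> sqrt ((3 * sqrt 5 + 3) / 4)"
  shows "S2 (exp (- (3 * sqrt 5 * pi))) = 1 / sqrt 2 * w * (c - d)"
    and "S2 (exp (- (sqrt 5 * pi / 3))) = 1 / sqrt 2 * w * (c + d)"
proof -
  define r where "r = sqrt ((1 + sqrt (5::real)) / 2)"
  note r = sqrt_sqrt_5_expressions[folded r_def]
  have w: "w = r\<^sup>2 - r" unfolding w_def by (rule r(4))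
  have w_inv: "w * (r\<^sup>2 + r) = 1"
  proof -
    have "w * (r\<^sup>2 + r) = r ^ 4 - r\<^sup>2" unfolding w by (simp add: power2_eq_square power4_eq_xxxx algebra_simps)
    then show ?thesis unfolding r(3) by simp
  qed
  have "r\<^sup>2 > r" using r(1) by (simp add: power2_eq_square)
  then have w0: "w > 0" unfolding w by simp
  have w1: "w < 1"
  proof -
    have "1 < r\<^sup>2 + r" using r(1) \<open>r\<^sup>2 > r\<close> by linarith
    then have "1 * (r\<^sup>2 + r) \<le> w * (r\<^sup>2 + r)" if "1 \<le> w"
      using that by (intro mult_right_mono) auto
    then show ?thesis using w_inv \<open>1 < r\<^sup>2 + r\<close> by (cases "w < 1") auto
  qed
  have winv: "1 / w = r\<^sup>2 + r" using w_inv w0 by (simp add: field_simps)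
  have "w\<^sup>2 + 1 / w\<^sup>2 = w\<^sup>2 + (1 / w)\<^sup>2" by (simp add: power_divide)
  also have "\<dots> = 2 * r ^ 4 + 2 * r\<^sup>2"
    unfolding winv unfolding w by (simp add: power2_eq_square power4_eq_xxxx algebra_simps)
  also have "\<dots> = 2 * (2 + sqrt 5)" unfolding r(3) r(2) by (simp add: field_simps)
  finally have "(jacobi_ratio (sqrt 5))\<^sup>2 + 1 / (jacobi_ratio (sqrt 5))\<^sup>2 = w\<^sup>2 + 1 / w\<^sup>2"
    using jacobi_ratio_sqrt_5 by simp
  moreover have "0 < jacobi_ratio (sqrt 5)" "jacobi_ratio (sqrt 5) < 1"
    by (simp_all add: jacobi_ratio_pos jacobi_ratio_less_1)
  ultimately have u: "jacobi_ratio (sqrt 5) = w"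
    using w0 w1 eq_if_sq_plus_inverse_eq by blast
  have s5: "sqrt 5 > (0::real)" by simp
  have "3 * sqrt 5 + 3 > (0::real)" by (intro add_pos_pos) auto
  then have cd: "0 < d" "d < c" "c\<^sup>2 - d\<^sup>2 = 1" by (simp_all add: c_def d_def field_simps)
  have sum: "2 * (c\<^sup>2 + d\<^sup>2) = 2 + 6 * r\<^sup>2" unfolding r(2) by (simp add: c_def d_def field_simps)
  \<comment> \<open>The second factor is forced: its constant term is \<open>1 / w^2\<close>, and
    the cubic term makes its linear coefficient \<open>w * (2 + 6 * r^2) - 4 * w^2\<close>, written
    here so that \<open>r > 1\<close> shows its sign.\<close>
  have factor: "x ^ 4 - 4 * (jacobi_ratio (sqrt 5))\<^sup>2 * x ^ 3 - 6 * x\<^sup>2 - 4 / (jacobi_ratio (sqrt 5))\<^sup>2 * x + 1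
      = (x\<^sup>2 - w * (2 * (c\<^sup>2 + d\<^sup>2)) * x + w\<^sup>2) * (x\<^sup>2 + 2 * (r\<^sup>2 - 1) * (r\<^sup>2 + r) * x + (r\<^sup>2 + r)\<^sup>2)" for x
  proof -
    have w4: "4 / w\<^sup>2 = 4 * (r\<^sup>2 + r)\<^sup>2" unfolding winv[symmetric] by (simp add: power_divide)
    have rr1: "r * (r * (r * r)) = r * r + 1"
      using r(3) by (simp only: power4_eq_xxxx power2_eq_square mult.assoc)
    have rr2: "r * (r * (r * (r * z))) = r * (r * z) + z" for z
    proof -
      have "r * (r * (r * (r * z))) = (r * (r * (r * r))) * z" by (simp only: mult.assoc)
      then show ?thesis unfolding rr1 by (simp only: distrib_right mult.assoc mult_1_left)
    qed
    show ?thesis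
      unfolding u sum w4 by (rule quartic_split) (simp_all add: w power2_eq_square algebra_simps rr1 rr2)
  qed
  have nonneg: "2 * (r\<^sup>2 - 1) * (r\<^sup>2 + r) \<ge> 0" "(r\<^sup>2 + r)\<^sup>2 > 0"
    using r(1) \<open>r\<^sup>2 > r\<close> by auto
  note J = jacobi_ratio_third_and_triple[OF s5 w0 cd nonneg factor, unfolded u, folded power2_eq_square[of w]]
  show "S2 (exp (- (3 * sqrt 5 * pi))) = 1 / sqrt 2 * w * (c - d)"
    "S2 (exp (- (sqrt 5 * pi / 3))) = 1 / sqrt 2 * w * (c + d)"
    by (rule S2_third_and_triple[OF s5 less_imp_le[OF w0] cd(1,2) J])+
qed

text \<open>The value at \<open>sqrt 7\<close> is \<open>u = (3 - sqrt 7) / sqrt 2\<close>, with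
  \<open>u^2 = 8 - 3 * sqrt 7\<close> a unit of norm 1. The parameter k is now
  \<open>2 - sqrt 3\<close>, the square of \<open>(sqrt 3 - 1) / sqrt 2\<close>, so that
  \<open>w^2 = u * k\<close> and only the root of u remains.\<close>

lemma S2_sqrt_7:
  defines "w \<equiv> sqrt ((3 - sqrt 7) / sqrt 2) * ((sqrt 3 - 1) / sqrt 2)"
    and "c \<equiv> sqrt ((sqrt 21 + 5) / 2)" and "d \<equiv> sqrt ((sqrt 21 + 3) / 2)"
  shows "S2 (exp (- (3 * sqrt 7 * pi))) = 1 / sqrt 2 * w * (c - d)"
    and "S2 (exp (- (sqrt 7 * pi / 3))) = 1 / sqrt 2 * w * (c + d)"
proof -
  define a b where "a = sqrt (7::real)" and "b = sqrt (3::real)"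
  have ab: "a\<^sup>2 = 7" "b\<^sup>2 = 3" "a * b = sqrt 21" by (simp_all add: a_def b_def flip: real_sqrt_mult)
  have bounds: "2 < a" "a < 3" "1 < b" "b < 2"
    by (simp_all add: a_def b_def real_less_rsqrt real_less_lsqrt)
  define u where "u = (3 - a) / sqrt 2"
  have u0: "u > 0" using bounds by (simp add: u_def)
  have u2: "u\<^sup>2 = 8 - 3 * a"
    using ab(1) by (simp add: u_def power_divide power2_diff field_simps)
  have u2inv: "1 / u\<^sup>2 = 8 + 3 * a"
  proof -
    have "u\<^sup>2 * (8 + 3 * a) = 1" unfolding u2 using ab(1) by (simp add: power2_eq_square algebra_simps)
    then show ?thesis using u0 by (simp add: field_simps)
  qed
  have u1: "u < 1"
  proof -
    have "u\<^sup>2 < 1\<^sup>2"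
    proof -
      have "a > 7 / 3" unfolding a_def by (rule real_less_rsqrt) (simp add: power_divide)
      then show ?thesis unfolding u2 by simp
    qed
    then show ?thesis by (rule power2_less_imp_less) simp
  qed
  have "(jacobi_ratio a)\<^sup>2 + 1 / (jacobi_ratio a)\<^sup>2 = u\<^sup>2 + 1 / u\<^sup>2"
    using jacobi_ratio_sqrt_7 unfolding a_def[symmetric] u2inv unfolding u2 by simp
  moreover have "0 < jacobi_ratio a" "jacobi_ratio a < 1"
    using bounds by (simp_all add: jacobi_ratio_pos jacobi_ratio_less_1)
  ultimately have u: "jacobi_ratio a = u"
    using u0 u1 eq_if_sq_plus_inverse_eq by blast
  have a0: "a > 0" using bounds by simp
  have k0: "2 - b > 0" using bounds by simp
  have "sqrt 21 + 3 > (0::real)" by (intro add_pos_pos) auto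
  then have cd: "0 < d" "d < c" "c\<^sup>2 - d\<^sup>2 = 1" by (simp_all add: c_def d_def field_simps)
  have sum: "2 * (c\<^sup>2 + d\<^sup>2) = 8 + 2 * (a * b)" unfolding ab(3) by (simp add: c_def d_def field_simps)
  \<comment> \<open>Again forced: the constant term is \<open>1 / (2 - b)^2\<close> and the linear
    coefficient is \<open>(2 - b) * (8 + 2 * (a * b)) - 4 * u^2\<close>.\<close>
  have factor: "x ^ 4 - 4 * (jacobi_ratio a)\<^sup>2 * x ^ 3 - 6 * x\<^sup>2 - 4 / (jacobi_ratio a)\<^sup>2 * x + 1
      = (x\<^sup>2 - (2 - b) * (2 * (c\<^sup>2 + d\<^sup>2)) * x + (2 - b)\<^sup>2) * (x\<^sup>2 + 2 * (2 + b) * (a * b - 4) * x + (2 + b)\<^sup>2)" for x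
  proof -
    have u4: "4 / u\<^sup>2 = 4 * (8 + 3 * a)" using u2inv by simp
    have aabb: "a * a = 7" "b * b = 3" "a * (a * z) = 7 * z" "b * (b * z) = 3 * z" for z
      using ab(1,2) unfolding power2_eq_square by (simp_all only: mult.assoc[symmetric])
    show ?thesis
      unfolding u sum u4 unfolding u2 by (rule quartic_split) (simp_all add: power2_eq_square algebra_simps aabb)
  qed
  have nonneg: "2 * (2 + b) * (a * b - 4) \<ge> 0" "(2 + b)\<^sup>2 > 0"
  proof -
    have "sqrt 21 \<ge> (4::real)" by (simp add: real_le_rsqrt)
    then show "2 * (2 + b) * (a * b - 4) \<ge> 0" unfolding ab(3) using bounds by simp
    show "(2 + b)\<^sup>2 > 0" using bounds by simp
  qed
  have w: "w\<^sup>2 = u * (2 - b)"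
  proof -
    have "w\<^sup>2 = (sqrt u)\<^sup>2 * ((b - 1)\<^sup>2 / 2)"
      unfolding w_def u_def a_def b_def by (simp add: power_mult_distrib power_divide)
    also have "(b - 1)\<^sup>2 / 2 = 2 - b" using ab(2) by (simp add: power2_diff)
    finally show ?thesis using u0 by simp
  qed
  have w0: "w \<ge> 0" unfolding w_def using bounds by (simp add: a_def b_def)
  note J = jacobi_ratio_third_and_triple[OF a0 k0 cd nonneg factor, unfolded u, folded w]
  show "S2 (exp (- (3 * sqrt 7 * pi))) = 1 / sqrt 2 * w * (c - d)"
    "S2 (exp (- (sqrt 7 * pi / 3))) = 1 / sqrt 2 * w * (c + d)"
    unfolding a_def[symmetric] by (rule S2_third_and_triple[OF a0 w0 cd(1,2) J])+
qed

theorem theorem5p4: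
  shows "S2 (exp (- 3 * sqrt 5 * pi)) =
           1 / sqrt 2 * (sqrt ((sqrt 5 + 3) / 4) - sqrt ((sqrt 5 - 1) / 4)) ^ 2 *
           (sqrt ((3 * sqrt 5 + 7) / 4) - sqrt ((3 * sqrt 5 + 3) / 4))
        \<and> S2 (exp (- sqrt 5 * pi / 3)) =
           1 / sqrt 2 * (sqrt ((sqrt 5 + 3) / 4) - sqrt ((sqrt 5 - 1) / 4)) ^ 2 *
           (sqrt ((3 * sqrt 5 + 7) / 4) + sqrt ((3 * sqrt 5 + 3) / 4))
        \<and> S2 (exp (- 3 * sqrt 7 * pi)) =
           1 / sqrt 2 * sqrt ((3 - sqrt 7) / sqrt 2) * ((sqrt 3 - 1) / sqrt 2) *
           (sqrt ((sqrt 21 + 5) / 2) - sqrt ((sqrt 21 + 3) / 2))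
        \<and> S2 (exp (- sqrt 7 * pi / 3)) =
           1 / sqrt 2 * sqrt ((3 - sqrt 7) / sqrt 2) * ((sqrt 3 - 1) / sqrt 2) *
           (sqrt ((sqrt 21 + 5) / 2) + sqrt ((sqrt 21 + 3) / 2))"
proof (intro conjI)
  have e: "- 3 * sqrt n * pi = - (3 * sqrt n * pi)" "- sqrt n * pi / 3 = - (sqrt n * pi / 3)" for n
    by simp_all
  show "S2 (exp (- 3 * sqrt 5 * pi)) =
           1 / sqrt 2 * (sqrt ((sqrt 5 + 3) / 4) - sqrt ((sqrt 5 - 1) / 4)) ^ 2 *
           (sqrt ((3 * sqrt 5 + 7) / 4) - sqrt ((3 * sqrt 5 + 3) / 4))"
    unfolding e by (rule S2_sqrt_5(1))
  show "S2 (exp (- sqrt 5 * pi / 3)) =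
           1 / sqrt 2 * (sqrt ((sqrt 5 + 3) / 4) - sqrt ((sqrt 5 - 1) / 4)) ^ 2 *
           (sqrt ((3 * sqrt 5 + 7) / 4) + sqrt ((3 * sqrt 5 + 3) / 4))"
    unfolding e by (rule S2_sqrt_5(2))
  show "S2 (exp (- 3 * sqrt 7 * pi)) =
           1 / sqrt 2 * sqrt ((3 - sqrt 7) / sqrt 2) * ((sqrt 3 - 1) / sqrt 2) *
           (sqrt ((sqrt 21 + 5) / 2) - sqrt ((sqrt 21 + 3) / 2))"
    unfolding e using S2_sqrt_7(1) by (simp only: mult.assoc)
  show "S2 (exp (- sqrt 7 * pi / 3)) =
           1 / sqrt 2 * sqrt ((3 - sqrt 7) / sqrt 2) * ((sqrt 3 - 1) / sqrt 2) *
           (sqrt ((sqrt 21 + 5) / 2) + sqrt ((sqrt 21 + 3) / 2))"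
    unfolding e using S2_sqrt_7(2) by (simp only: mult.assoc)
qed

end
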